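(* Let $(\Omega,\mathcal F,\mathbb P)$ be a probability space. For a random variable $Y$ and a $\sigma$-lattice $\mathcal A\subseteq\mathcal F$, the isotonic conditional law (ICL) $P_{Y\mid\mathcal A}$ satisfies the following properties. 1. The ICL $P_{Y\mid\mathcal A}$ minimizes $\mathbb E\,\mathrm S(G,Y)$ over all $G\in\mathscr G_{\mathcal A}$, uniquely in the sense that $P_{Y\mid\mathcal A}(\cdot,B)=G(\cdot,B)$ almost surely for all $B\in\mathcal B(\mathbb R)$ for any minimizer $G\in\mathscr G_{\mathcal A}$, under any scoring rule $\mathrm S$ of the form $$\mathrm S(F,y)=\int_{\mathbb R\times\mathbb R}S^E_\eta(F(z),\mathbf 1_{\{y\le z\}})\,\mathrm dH(z,\eta),$$ where $H$ is a $\sigma$-finite Borel measure on $\mathbb R\times\mathbb R$. Moreover, for every threshold value $z\in\mathbb R$, $P_{Y\mid\mathcal A}(\cdot,(z,\infty))$ is a minimizer of $\mathbb E\,S(X,\mathbf 1_{\{Y>z\}})$ over all $\mathcal A$-measurable random variables $X$, where $S$ is any consistent scoring function for the mean, that is, $S(x,y)=\int S^E_\eta(x,y)\,\mathrm d\tilde H(\eta)$ for some $\sigma$-finite Borel measure $\tilde H$ on $\mathbb R$. 2. Suppose that, for any $\alpha\in(0,1)$, the random vector $(P^{-1}_{Y\mid\mathcal A}(\alpha),Y)$ satisfies the following: its joint distribution is absolutely continuous, or the marginal distribution of $P^{-1}_{Y\mid\mathcal A}(\alpha)$ has countable support without accumulation points (i.e. the support consists of countably many isolated points). Then the ICL $P_{Y\mid\mathcal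 A}$ minimizes $\mathbb E\,\mathrm S(G,Y)$ over all $G\in\mathscr G_{\mathcal A}$, uniquely in the same sense as in part 1, under any scoring rule $\mathrm S$ of the form $$\mathrm S(F,y)=\int_{(0,1)\times\mathbb R}S^Q_{\alpha,\eta}(F^{-1}(\alpha),y)\,\mathrm dH(\alpha,\eta),$$ where $H$ is a $\sigma$-finite Borel measure on $(0,1)\times\mathbb R$. Moreover, for every quantile level $\alpha\in(0,1)$, $P^{-1}_{Y\mid\mathcal A}(\alpha)$ minimizes $\mathbb E\,S(X,Y)$ over all $\mathcal A$-measurable random variables $X$, where $S$ is any consistent scoring function for the $\alpha$-quantile, that is, $S(x,y)=\int S^Q_{\alpha,\eta}(x,y)\,\mathrm d\tilde H(\eta)$ for a $\sigma$-finite Borel measure $\tilde H$ on $\mathbb R$.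
   Context: Elementary scores, for $x,y,\eta\in\mathbb R$ and $\alpha\in(0,1)$: $S^E_\eta(x,y)=(\eta-y)\mathbf 1_{\{y<\eta\le x\}}+(y-\eta)\mathbf 1_{\{x<\eta\le y\}}$ and $S^Q_{\alpha,\eta}(x,y)=(1-\alpha)\mathbf 1_{\{y<\eta\le x\}}+\alpha\mathbf 1_{\{x<\eta\le y\}}$. A $\sigma$-lattice $\mathcal A\subseteq\mathcal F$ contains $\emptyset,\Omega$ and is closed under countable unions and intersections. A random variable $X$ is $\mathcal A$-measurable if $\{X>x\}\in\mathcal A$ for all $x\in\mathbb R$. For integrable $Z$, $\mathbb E(Z\mid\mathcal A)$ is the (a.s. unique) integrable $\mathcal A$-measurable random variable $X$ with $\mathbb E(Z\mathbf 1_A)\le\mathbb E(X\mathbf 1_A)$ for all $A\in\mathcal A$ and $\mathbb E(X\mathbf 1_B)=\mathbb E(Z\mathbf 1_B)$ for all $B\in\sigma(X)$; $\mathbb P(B\mid\mathcal A)=\mathbb E(\mathbf 1_B\mid\mathcal A)$. The ICL $P_{Y\mid\mathcal A}$ is the (a.s. unique) Markov kernel from $(\Omega,\mathcal F)$ to $(\mathbb R,\mathcal B(\mathbb R))$ such that $P_{Y\mid\mathcal A}(\cdot,(y,\infty))$ is a version of $\mathbb P(Y>y\mid\mathcal A)$ for every $y\in\mathbb R$. $\mathscr G_{\mathcal A}$ is the class of all Markov kernels $G$ from $(\Omega,\mathcal F)$ to $(\mathbb R,\mathcal B(\mathbb R))$ such that $G(\cdot,(z,\infty))$ is $\mathcal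 A$-measurable for all $z\in\mathbb R$. Kernels are regarded as random cdfs, $G(z)=G(\cdot,(-\infty,z])$. For a cdf $F$ and $\alpha\in(0,1)$, $F^{-1}(\alpha)=\inf\{z\in\mathbb R\mid F(z)\ge\alpha\}$; $P^{-1}_{Y\mid\mathcal A}(\alpha)$ is the resulting random variable for the random cdf $P_{Y\mid\mathcal A}$.
   Formalization: Uniqueness fails for some H (e.g. H=0); it is proved for G minimizing under all rules of the form, and for one rule if E S(P,Y) is finite and H charges every nonempty open subset of R×(0,1) (part 1) or (0,1)×R (part 2). *)

theory Defs
  imports "HOL-Probability.Probability"
begin

subsection \<open>Elementary scores\<close>

definition score_E :: "real \<Rightarrow> real \<Rightarrow> real \<Rightarrow> real" where
  "score_E \<eta> x y = (\<eta> - y) * of_bool (y < \<eta> \<and> \<eta> \<le> x) + (y - \<eta>) * of_bool (x < \<eta> \<and> \<eta> \<le> y)"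

definition score_Q :: "real \<Rightarrow> real \<Rightarrow> real \<Rightarrow> real \<Rightarrow> real" where
  "score_Q \<alpha> \<eta> x y = (1 - \<alpha>) * of_bool (y < \<eta> \<and> \<eta> \<le> x) + \<alpha> * of_bool (x < \<eta> \<and> \<eta> \<le> y)"


subsection \<open>\<open>\<sigma>\<close>-lattices, conditional expectations and isotonic conditional laws\<close>

definition sigma_lattice :: "'a measure \<Rightarrow> 'a set set \<Rightarrow> bool" where
  "sigma_lattice M \<A> \<longleftrightarrow> \<A> \<subseteq> sets M \<and> {} \<in> \<A> \<and> space M \<in> \<A> \<and>
     (\<forall>B :: nat \<Rightarrow> 'a set. range B \<subseteq> \<A> \<longrightarrow> (\<Union>n. B n) \<in> \<A> \<and> (\<Inter>n. B n) \<in> \<A>)"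

definition lattice_measurable :: "'a measure \<Rightarrow> 'a set set \<Rightarrow> ('a \<Rightarrow> real) \<Rightarrow> bool" where
  "lattice_measurable M \<A> X \<longleftrightarrow>
     X \<in> borel_measurable M \<and> (\<forall>x. {\<omega> \<in> space M. X \<omega> > x} \<in> \<A>)"

text \<open>\<open>X\<close> is a version of \<open>\<bbbE>(Z | \<A>)\<close>; the sigma-algebra generated by \<open>X\<close> is
  \<^term>\<open>vimage_algebra (space M) X borel\<close>.\<close>

definition is_cond_exp :: "'a measure \<Rightarrow> 'a set set \<Rightarrow> ('a \<Rightarrow> real) \<Rightarrow> ('a \<Rightarrow> real) \<Rightarrow> bool" where
  "is_cond_exp M \<A> Z X \<longleftrightarrow>
     integrable M Z \<and> integrable M X \<and> lattice_measurable M \<A> X \<and>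
     (\<forall>A \<in> \<A>. (\<integral>\<omega>. Z \<omega> * indicator A \<omega> \<partial>M) \<le> (\<integral>\<omega>. X \<omega> * indicator A \<omega> \<partial>M)) \<and>
     (\<forall>B \<in> sets (vimage_algebra (space M) X borel).
        (\<integral>\<omega>. X \<omega> * indicator B \<omega> \<partial>M) = (\<integral>\<omega>. Z \<omega> * indicator B \<omega> \<partial>M))"

definition is_cond_prob :: "'a measure \<Rightarrow> 'a set set \<Rightarrow> 'a set \<Rightarrow> ('a \<Rightarrow> real) \<Rightarrow> bool" where
  "is_cond_prob M \<A> B X \<longleftrightarrow> is_cond_exp M \<A> (indicator B) X"

text \<open>A Markov kernel from \<open>M\<close> to the Borel sets of \<open>\<real>\<close> is a measurable map from \<open>M\<close> into
  \<^term>\<open>prob_algebra borel\<close>; the associated random cdf is \<open>\<lambda>\<omega>. cdf (G \<omega>)\<close>.\<close>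

definition is_ICL ::
  "'a measure \<Rightarrow> 'a set set \<Rightarrow> ('a \<Rightarrow> real) \<Rightarrow> ('a \<Rightarrow> real measure) \<Rightarrow> bool" where
  "is_ICL M \<A> Y P \<longleftrightarrow> P \<in> M \<rightarrow>\<^sub>M prob_algebra borel \<and>
     (\<forall>y. is_cond_prob M \<A> {\<omega> \<in> space M. Y \<omega> > y} (\<lambda>\<omega>. measure (P \<omega>) {y<..}))"

definition lattice_kernel :: "'a measure \<Rightarrow> 'a set set \<Rightarrow> ('a \<Rightarrow> real measure) \<Rightarrow> bool" where
  "lattice_kernel M \<A> G \<longleftrightarrow> G \<in> M \<rightarrow>\<^sub>M prob_algebra borel \<and>
     (\<forall>z. lattice_measurable M \<A> (\<lambda>\<omega>. measure (G \<omega>) {z<..}))"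

definition kernel_AE_eq ::
  "'a measure \<Rightarrow> ('a \<Rightarrow> real measure) \<Rightarrow> ('a \<Rightarrow> real measure) \<Rightarrow> bool" where
  "kernel_AE_eq M P G \<longleftrightarrow> (\<forall>B \<in> sets borel. AE \<omega> in M. measure (P \<omega>) B = measure (G \<omega>) B)"

definition quantile :: "(real \<Rightarrow> real) \<Rightarrow> real \<Rightarrow> real" where
  "quantile F \<alpha> = Inf {z. F z \<ge> \<alpha>}"


subsection \<open>Mixtures of elementary scores\<close>

text \<open>The elementary scores are nonnegative for \<open>\<alpha> \<in> (0,1)\<close>, so the mixtures and the expected
  scores are defined with values in \<open>[0,\<infinity>]\<close>, without integrability assumptions.\<close>

definition mean_score :: "real measure \<Rightarrow> real \<Rightarrow> real \<Rightarrow> ennreal" where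
  "mean_score H x y = (\<integral>\<^sup>+\<eta>. ennreal (score_E \<eta> x y) \<partial>H)"

definition quantile_score :: "real \<Rightarrow> real measure \<Rightarrow> real \<Rightarrow> real \<Rightarrow> ennreal" where
  "quantile_score \<alpha> H x y = (\<integral>\<^sup>+\<eta>. ennreal (score_Q \<alpha> \<eta> x y) \<partial>H)"

definition threshold_rule :: "(real \<times> real) measure \<Rightarrow> (real \<Rightarrow> real) \<Rightarrow> real \<Rightarrow> ennreal" where
  "threshold_rule H F y = (\<integral>\<^sup>+(z, \<eta>). ennreal (score_E \<eta> (F z) (of_bool (y \<le> z))) \<partial>H)"

definition quantile_rule :: "(real \<times> real) measure \<Rightarrow> (real \<Rightarrow> real) \<Rightarrow> real \<Rightarrow> ennreal" where
  "quantile_rule H F y = (\<integral>\<^sup>+(\<alpha>, \<eta>). ennreal (score_Q \<alpha> \<eta> (quantile F \<alpha>) y) \<partial>H)"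

definition expected_rule ::
  "'a measure \<Rightarrow> ('a \<Rightarrow> real) \<Rightarrow> ((real \<Rightarrow> real) \<Rightarrow> real \<Rightarrow> ennreal) \<Rightarrow> ('a \<Rightarrow> real measure) \<Rightarrow> ennreal"
  where "expected_rule M Y S G = (\<integral>\<^sup>+\<omega>. S (cdf (G \<omega>)) (Y \<omega>) \<partial>M)"

definition sigma_finite_borel_on :: "'b::topological_space set \<Rightarrow> 'b measure \<Rightarrow> bool" where
  "sigma_finite_borel_on D H \<longleftrightarrow> sets H = sets (restrict_space borel D) \<and> sigma_finite_measure H"


subsection \<open>Supports and the uniqueness statement\<close>

definition measure_support :: "'b::topological_space measure \<Rightarrow> 'b set" where
  "measure_support \<mu> = {x \<in> space \<mu>. \<forall>U. open U \<and> x \<in> U \<longrightarrow> emeasure \<mu> (U \<inter> space \<mu>) > 0}"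

text \<open>Uniqueness up to almost sure equality cannot hold for each scoring rule of a mixture family
  separately: for \<open>H = 0\<close>, or if the minimal expected score is infinite, every competitor is a
  minimizer, and for a point mass \<open>H\<close> a minimizer is only determined at a single pair of
  parameters. The predicate below therefore expresses uniqueness of the minimizer in the following
  two senses:

  \<^item> a kernel that is a minimizer under every rule of the family agrees with \<open>P\<close>;

  \<^item> for a single rule whose mixing measure \<open>H\<close> charges every nonempty open subset of the relevant
    parameter set \<open>W\<close>, and whose expected score at \<open>P\<close> is finite, each minimizer agrees with \<open>P\<close>.\<close>

definition unique_minimizer ::
  "'a measure \<Rightarrow> 'a set set \<Rightarrow> ('a \<Rightarrow> real) \<Rightarrow> (real \<times> real) set \<Rightarrow> (real \<times> real) set \<Rightarrow>
   ((real \<times> real) measure \<Rightarrow> (real \<Rightarrow> real) \<Rightarrow> real \<Rightarrow> ennreal) \<Rightarrow> ('a \<Rightarrow> real measure) \<Rightarrow> bool" where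
  "unique_minimizer M \<A> Y D W S P \<longleftrightarrow>
     (\<forall>G. (\<forall>H. sigma_finite_borel_on D H \<longrightarrow>
              is_arg_min (expected_rule M Y (S H)) (lattice_kernel M \<A>) G) \<longrightarrow>
          kernel_AE_eq M P G) \<and>
     (\<forall>H G. sigma_finite_borel_on D H \<and> W \<subseteq> measure_support H \<and>
            expected_rule M Y (S H) P < \<infinity> \<and>
            is_arg_min (expected_rule M Y (S H)) (lattice_kernel M \<A>) G \<longrightarrow>
          kernel_AE_eq M P G)"

end

theory Submission
  imports Defs
begin

text \<open>
  Both elementary scores factor: with \<open>Z\<close> the indicator of an exceedance event of \<open>Y\<close>, the score of a
  report is \<open>(Z - c) * (1\<^sub>E - 1\<^sub>A)\<close>, where \<open>E\<close> does not depend on the report and \<open>A\<close> is the event that the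
  report exceeds the threshold, a member of the \<open>\<sigma>\<close>-lattice. Minimizing the expected score thus means
  maximizing \<open>\<integral>\<^sub>A (Z - c)\<close> over the lattice. For \<open>X = \<bbbE>(Z | \<A>)\<close> this integral is at most \<open>\<integral>\<^sub>A (X - c)\<close>, which
  is largest for a set between \<open>{X > c}\<close> and \<open>{X \<ge> c}\<close>; for level sets of \<open>X\<close> both integrals agree. The
  mixtures follow by Tonelli's theorem. Conversely, equality forces \<open>{X > c} \<subseteq> A \<subseteq> {X \<ge> c}\<close> almost surely,
  and this information at a dense set of parameters determines the kernel.
\<close>

section \<open>Factorization and sign of the elementary scores\<close>

lemma score_E_eq: "score_E \<eta> x y = (\<eta> - y) * (of_bool (\<eta> \<le> x) - of_bool (\<eta> \<le> y))"
  by (auto simp: score_E_def of_bool_def)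

text \<open>The difference of indicators is 1 or -1 exactly on the two events of the score. In the
  first case \<open>\<eta> \<le> y\<close> fails and the prefactor is \<open>1 - \<alpha>\<close>,
  in the second it is \<open>- \<alpha>\<close>.\<close>

lemma score_Q_eq:
  "score_Q \<alpha> \<eta> x y = (1 - \<alpha> - of_bool (\<eta> \<le> y)) * (of_bool (\<eta> \<le> x) - of_bool (\<eta> \<le> y))"
  by (auto simp: score_Q_def of_bool_def)

lemma score_E_nonneg: "0 \<le> score_E \<eta> x y"
  by (auto simp: score_E_def of_bool_def)

lemma score_Q_nonneg: "0 < \<alpha> \<Longrightarrow> \<alpha> < 1 \<Longrightarrow> 0 \<le> score_Q \<alpha> \<eta> x y"
  by (auto simp: score_Q_def of_bool_def)

subsection \<open>Random cdfs and quantiles\<close>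

text \<open>The Galois connection between cdf and quantile. The limits at both ends of the line make
  the set under the infimum bounded below and nonempty.\<close>

lemma (in real_distribution) less_quantile_iff:
  assumes "0 < \<alpha>" "\<alpha> < 1"
  shows "x < quantile (cdf M) \<alpha> \<longleftrightarrow> cdf M x < \<alpha>"
proof
  let ?S = "{z. cdf M z \<ge> \<alpha>}"
  have "eventually (\<lambda>z. cdf M z < \<alpha>) at_bot"
    by (rule order_tendstoD(2)[OF cdf_lim_at_bot]) (use assms in simp)
  then obtain l where l: "\<And>z. z \<le> l \<Longrightarrow> cdf M z < \<alpha>"
    by (auto simp: eventually_at_bot_linorder)
  have bdd: "bdd_below ?S"
    by (rule bdd_belowI[of _ l]) (metis l linear mem_Collect_eq not_less)
  have "eventually (\<lambda>z. \<alpha> < cdf M z) at_top"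
    by (rule order_tendstoD(1)[OF cdf_lim_at_top_prob]) (use assms in simp)
  then obtain u where u: "\<alpha> < cdf M u"
    by (auto simp: eventually_at_top_linorder)
  show "cdf M x < \<alpha>" if "x < quantile (cdf M) \<alpha>"
  proof (rule ccontr)
    assume "\<not> cdf M x < \<alpha>"
    then have "quantile (cdf M) \<alpha> \<le> x"
      unfolding quantile_def by (intro cInf_lower bdd) simp
    with that show False by simp
  qed
  show "x < quantile (cdf M) \<alpha>" if less: "cdf M x < \<alpha>"
  proof -
    \<comment> \<open>Right continuity keeps the cdf below \<alpha> up to some \<open>y\<close> to
      the right of \<open>x\<close>, so the infimum is at least \<open>y\<close> and hence strictly
      above \<open>x\<close>.\<close>
    have "(cdf M \<longlongrightarrow> cdf M x) (at_right x)"
      using cdf_is_right_cont by (simp add: continuous_within)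
    then have "eventually (\<lambda>z. cdf M z < \<alpha>) (at_right x)"
      using less by (rule order_tendstoD(2))
    then obtain b where b: "b > x" "\<And>z. x < z \<Longrightarrow> z < b \<Longrightarrow> cdf M z < \<alpha>"
      by (auto simp: eventually_at_right_field)
    obtain y where y: "x < y" "y < b" using dense b(1) by blast
    have "y \<le> z" if "z \<in> ?S" for z
      using that b(2)[OF y] cdf_nondecreasing[of z y] by force
    then have "y \<le> quantile (cdf M) \<alpha>"
      unfolding quantile_def using u by (intro cInf_greatest) (auto intro: less_imp_le)
    with y show ?thesis by simp
  qed
qed

lemma (in real_distribution) cdf_eq_upper: "cdf M z = 1 - measure M {z<..}"
proof -
  have "{..z} = space M - {z<..}" by auto
  then show ?thesis
    unfolding cdf_def2 using prob_compl[of "{z<..}"] by simp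
qed

text \<open>To the left of \<eta> the cdf is at most \<alpha>, hence so is its left limit at \<eta>,
  the mass of \<open>{..<\<eta>}\<close>. The half-line is closed because \<eta> may be an
  atom.\<close>

lemma (in real_distribution) upper_measure_ge:
  assumes "0 < \<alpha>" "\<alpha> < 1" "\<eta> \<le> quantile (cdf M) \<alpha>"
  shows "1 - \<alpha> \<le> measure M {\<eta>..}"
proof -
  have "cdf M z \<le> \<alpha>" if "z < \<eta>" for z
    using less_quantile_iff[OF assms(1,2), of z] that assms(3) by simp
  then have "eventually (\<lambda>z. cdf M z \<le> \<alpha>) (at_left \<eta>)"
    by (simp add: eventually_at_filter)
  then have "measure M {..<\<eta>} \<le> \<alpha>"
    by (intro tendsto_upperbound[OF cdf_at_left]) auto
  moreover have "{\<eta>..} = space M - {..<\<eta>}" by auto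
  ultimately show ?thesis
    using prob_compl[of "{..<\<eta>}"] by simp
qed

lemma kernel_real_distribution:
  assumes "G \<in> M \<rightarrow>\<^sub>M prob_algebra borel" "\<omega> \<in> space M"
  shows "real_distribution (G \<omega>)"
  using measurable_space[OF assms]
  by (auto simp: space_prob_algebra real_distribution_def real_distribution_axioms_def)

text \<open>The cdf value is the kernel mass of a section of the measurable relation \<le>.
  Tonelli's theorem needs this measurability jointly in \<omega> and \<open>z\<close>.\<close>

lemma kernel_cdf_measurable:
  assumes "G \<in> M \<rightarrow>\<^sub>M prob_algebra borel"
  shows "(\<lambda>(\<omega>, z). cdf (G \<omega>) z) \<in> borel_measurable (M \<Otimes>\<^sub>M borel)"
proof -
  have G: "G \<in> M \<rightarrow>\<^sub>M subprob_algebra borel"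
    using assms(1) by (rule measurable_prob_algebraD)
  have "(\<lambda>w. measure (G (fst w)) {..snd w}) \<in> borel_measurable (M \<Otimes>\<^sub>M borel)"
  proof (rule measure_measurable_subprob_algebra2)
    have "(SIGMA x:space (M \<Otimes>\<^sub>M borel). {..snd x}) = {w \<in> space ((M \<Otimes>\<^sub>M borel) \<Otimes>\<^sub>M borel). (snd w :: real) \<le> snd (fst w)}"
      by (auto simp: space_pair_measure)
    also have "\<dots> \<in> sets ((M \<Otimes>\<^sub>M borel) \<Otimes>\<^sub>M borel)" by measurable
    finally show "(SIGMA x:space (M \<Otimes>\<^sub>M borel). {..snd x :: real}) \<in> sets ((M \<Otimes>\<^sub>M borel) \<Otimes>\<^sub>M borel)" .
    show "(\<lambda>w. G (fst w)) \<in> M \<Otimes>\<^sub>M borel \<rightarrow>\<^sub>M subprob_algebra borel"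
      using G by measurable
  qed
  then show ?thesis by (simp add: cdf_def2 case_prod_beta)
qed

text \<open>A \<sigma>-lattice need not contain complements, so the closed superlevel set is
  obtained as a countable intersection of open ones.\<close>

lemma lattice_measurable_ge:
  assumes "sigma_lattice M \<A>" "lattice_measurable M \<A> X"
  shows "{\<omega> \<in> space M. X \<omega> \<ge> x} \<in> \<A>"
proof -
  let ?B = "\<lambda>n::nat. {\<omega> \<in> space M. X \<omega> > x - 1 / real (Suc n)}"
  have "range ?B \<subseteq> \<A>"
    using assms(2) by (auto simp: lattice_measurable_def)
  then have "(\<Inter>n. ?B n) \<in> \<A>"
    using assms(1) unfolding sigma_lattice_def by blast
  moreover have "(\<Inter>n. ?B n) = {\<omega> \<in> space M. X \<omega> \<ge> x}"
  proof -
    have "x \<le> y" if "\<And>n::nat. x - 1 / real (Suc n) < y" for y :: real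
    proof (rule ccontr)
      assume "\<not> x \<le> y"
      then obtain n where "1 / real (Suc n) < x - y"
        using nat_approx_posE[of "x - y"] by auto
      with that[of n] show False by simp
    qed
    moreover have "x - 1 / real (Suc n) < y" if "x \<le> y" for y :: real and n
      using that by (intro less_le_trans[of _ x y]) auto
    ultimately show ?thesis by auto
  qed
  ultimately show ?thesis by simp
qed

text \<open>A quantile exceeds \<open>x\<close> exactly when the mass above \<open>x\<close> exceeds
  \<open>1 - \<alpha>\<close>, so its superlevel sets are superlevel sets of tail
  probabilities.\<close>

lemma lattice_measurable_quantile:
  assumes "lattice_kernel M \<A> G" "0 < \<alpha>" "\<alpha> < 1"
  shows "lattice_measurable M \<A> (\<lambda>\<omega>. quantile (cdf (G \<omega>)) \<alpha>)"
proof -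
  have G: "G \<in> M \<rightarrow>\<^sub>M prob_algebra borel"
    and L: "\<And>z. lattice_measurable M \<A> (\<lambda>\<omega>. measure (G \<omega>) {z<..})"
    using assms(1) by (auto simp: lattice_kernel_def)
  have eq: "{\<omega> \<in> space M. quantile (cdf (G \<omega>)) \<alpha> > x} = {\<omega> \<in> space M. measure (G \<omega>) {x<..} > 1 - \<alpha>}" for x
    using real_distribution.less_quantile_iff[OF kernel_real_distribution[OF G] assms(2,3)]
      real_distribution.cdf_eq_upper[OF kernel_real_distribution[OF G]]
    by auto
  show ?thesis
    unfolding lattice_measurable_def borel_measurable_iff_greater eq
    using L by (auto simp: lattice_measurable_def borel_measurable_iff_greater)
qed

subsection \<open>Optimal sets\<close>

text \<open>Only the equality on \<open>U\<close> itself is required, not on all of \<open>\<sigma>(X)\<close>, because the set belonging to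
  a quantile is handled as a limit of level sets of varying conditional probabilities.\<close>

definition optimal_level_set ::
  "'a measure \<Rightarrow> 'a set set \<Rightarrow> ('a \<Rightarrow> real) \<Rightarrow> ('a \<Rightarrow> real) \<Rightarrow> real \<Rightarrow> 'a set \<Rightarrow> bool" where
  "optimal_level_set M \<A> Z X c U \<longleftrightarrow> integrable M Z \<and> integrable M X \<and> U \<in> sets M \<and>
     (\<forall>A \<in> \<A>. (\<integral>\<omega>. Z \<omega> * indicator A \<omega> \<partial>M) \<le> (\<integral>\<omega>. X \<omega> * indicator A \<omega> \<partial>M)) \<and>
     (\<integral>\<omega>. X \<omega> * indicator U \<omega> \<partial>M) = (\<integral>\<omega>. Z \<omega> * indicator U \<omega> \<partial>M) \<and>
     (\<forall>\<omega> \<in> space M. (X \<omega> > c \<longrightarrow> \<omega> \<in> U) \<and> (\<omega> \<in> U \<longrightarrow> X \<omega> \<ge> c))"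

context prob_space
begin

lemma integrable_shift_indicator:
  fixes Z :: "'a \<Rightarrow> real"
  assumes "integrable M Z" "A \<in> sets M"
  shows "integrable M (\<lambda>\<omega>. (Z \<omega> - c) * indicator A \<omega>)"
  using assms by (intro integrable_real_mult_indicator) auto

lemma integral_shift_indicator:
  fixes Z :: "'a \<Rightarrow> real"
  assumes "integrable M Z" "A \<in> sets M"
  shows "(\<integral>\<omega>. (Z \<omega> - c) * indicator A \<omega> \<partial>M) = (\<integral>\<omega>. Z \<omega> * indicator A \<omega> \<partial>M) - c * prob A"
proof -
  have "(\<integral>\<omega>. (Z \<omega> - c) * indicator A \<omega> \<partial>M) =
      (\<integral>\<omega>. Z \<omega> * indicator A \<omega> - c * indicator A \<omega> \<partial>M)"
    by (simp add: left_diff_distrib)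
  also have "\<dots> = (\<integral>\<omega>. Z \<omega> * indicator A \<omega> \<partial>M) - (\<integral>\<omega>. c * indicator A \<omega> \<partial>M)"
    using assms by (intro Bochner_Integration.integral_diff integrable_real_mult_indicator) auto
  finally show ?thesis using assms by (simp add: sets.Int_space_eq2)
qed

text \<open>The integral of \<open>Z - c\<close> over \<open>A\<close> is at most that of
  \<open>X - c\<close> over \<open>A\<close>, this is at most that of \<open>X - c\<close> over
  \<open>U\<close>, and the latter equals that of \<open>Z - c\<close> over \<open>U\<close>. If the
  two ends agree, the nonnegative gap in the middle comparison vanishes almost surely.\<close>

lemma optimal_level_set_maximal:
  assumes opt: "optimal_level_set M \<A> Z X c U" and A: "A \<in> \<A>" "A \<in> sets M"
  shows optimal_level_set_le: "(\<integral>\<omega>. (Z \<omega> - c) * indicator A \<omega> \<partial>M) \<le> (\<integral>\<omega>. (Z \<omega> - c) * indicator U \<omega> \<partial>M)"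
    and optimal_level_set_AE:
      "(\<integral>\<omega>. (Z \<omega> - c) * indicator U \<omega> \<partial>M) \<le> (\<integral>\<omega>. (Z \<omega> - c) * indicator A \<omega> \<partial>M) \<Longrightarrow>
        AE \<omega> in M. (X \<omega> > c \<longrightarrow> \<omega> \<in> A) \<and> (\<omega> \<in> A \<longrightarrow> X \<omega> \<ge> c)"
proof -
  have Z: "integrable M Z" and X: "integrable M X" and U: "U \<in> sets M"
    and up: "\<And>\<omega>. \<omega> \<in> space M \<Longrightarrow> X \<omega> > c \<Longrightarrow> \<omega> \<in> U"
    and low: "\<And>\<omega>. \<omega> \<in> space M \<Longrightarrow> \<omega> \<in> U \<Longrightarrow> X \<omega> \<ge> c"
    using opt by (auto simp: optimal_level_set_def)
  \<comment> \<open>Off \<open>U\<close> the value \<open>X \<omega> - c\<close> is at most 0 and on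
    \<open>U\<close> it is at least 0, so replacing \<open>A\<close> by \<open>U\<close> drops
    nonpositive and adds nonnegative contributions.\<close>
  have pw: "(X \<omega> - c) * indicator A \<omega> \<le> (X \<omega> - c) * indicator U \<omega>" if "\<omega> \<in> space M" for \<omega>
    using up[OF that] low[OF that] by (auto simp: indicator_def not_less[symmetric])
  have ZX: "(\<integral>\<omega>. (Z \<omega> - c) * indicator A \<omega> \<partial>M) \<le> (\<integral>\<omega>. (X \<omega> - c) * indicator A \<omega> \<partial>M)"
    using opt A by (simp add: optimal_level_set_def integral_shift_indicator)
  have XZ: "(\<integral>\<omega>. (X \<omega> - c) * indicator U \<omega> \<partial>M) = (\<integral>\<omega>. (Z \<omega> - c) * indicator U \<omega> \<partial>M)"
    using opt by (simp add: optimal_level_set_def integral_shift_indicator)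
  have XX: "(\<integral>\<omega>. (X \<omega> - c) * indicator A \<omega> \<partial>M) \<le> (\<integral>\<omega>. (X \<omega> - c) * indicator U \<omega> \<partial>M)"
    using X U A by (intro integral_mono pw integrable_shift_indicator)
  show "(\<integral>\<omega>. (Z \<omega> - c) * indicator A \<omega> \<partial>M) \<le> (\<integral>\<omega>. (Z \<omega> - c) * indicator U \<omega> \<partial>M)"
    using ZX XX XZ by simp
  assume "(\<integral>\<omega>. (Z \<omega> - c) * indicator U \<omega> \<partial>M) \<le> (\<integral>\<omega>. (Z \<omega> - c) * indicator A \<omega> \<partial>M)"
  with ZX XX XZ have "(\<integral>\<omega>. (X \<omega> - c) * indicator U \<omega> - (X \<omega> - c) * indicator A \<omega> \<partial>M) = 0"
    using X U A by (subst Bochner_Integration.integral_diff) (auto intro: integrable_shift_indicator)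
  then have "AE \<omega> in M. (X \<omega> - c) * indicator U \<omega> - (X \<omega> - c) * indicator A \<omega> = 0"
    using X U A pw
    by (subst (asm) integral_nonneg_eq_0_iff_AE)
      (auto intro!: Bochner_Integration.integrable_diff integrable_shift_indicator)
  then show "AE \<omega> in M. (X \<omega> > c \<longrightarrow> \<omega> \<in> A) \<and> (\<omega> \<in> A \<longrightarrow> X \<omega> \<ge> c)"
  proof (rule AE_mp, intro AE_I2 impI)
    \<comment> \<open>At a point of exactly one of \<open>U\<close> and \<open>A\<close> the
      vanishing difference gives \<open>X \<omega> = c\<close>, which agrees with both
      implications.\<close>
    fix \<omega> assume "\<omega> \<in> space M" "(X \<omega> - c) * indicator U \<omega> - (X \<omega> - c) * indicator A \<omega> = 0"
    with up low show "(X \<omega> > c \<longrightarrow> \<omega> \<in> A) \<and> (\<omega> \<in> A \<longrightarrow> X \<omega> \<ge> c)"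
      by (cases "\<omega> \<in> U"; cases "\<omega> \<in> A") auto
  qed
qed

text \<open>The contribution of \<open>E\<close> is finite and the same for every report, so
  comparing expected scores amounts to comparing the integrals of \<open>Z - c\<close> over
  \<open>U\<close> and \<open>A\<close>.\<close>

lemma expected_score_optimal:
  fixes Z X s t :: "'a \<Rightarrow> real"
  assumes opt: "optimal_level_set M \<A> Z X c U" and A: "A \<in> \<A>" "A \<in> sets M"
    and E: "E \<in> sets M"
    and s: "\<And>\<omega>. \<omega> \<in> space M \<Longrightarrow> s \<omega> = (Z \<omega> - c) * (indicator E \<omega> - indicator U \<omega>)"
    and t: "\<And>\<omega>. \<omega> \<in> space M \<Longrightarrow> t \<omega> = (Z \<omega> - c) * (indicator E \<omega> - indicator A \<omega>)"
    and nonneg: "\<And>\<omega>. 0 \<le> s \<omega>" "\<And>\<omega>. 0 \<le> t \<omega>"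
  shows expected_score_le: "(\<integral>\<^sup>+\<omega>. ennreal (s \<omega>) \<partial>M) \<le> (\<integral>\<^sup>+\<omega>. ennreal (t \<omega>) \<partial>M)"
    and expected_score_AE: "(\<integral>\<^sup>+\<omega>. ennreal (t \<omega>) \<partial>M) \<le> (\<integral>\<^sup>+\<omega>. ennreal (s \<omega>) \<partial>M) \<Longrightarrow>
      AE \<omega> in M. (X \<omega> > c \<longrightarrow> \<omega> \<in> A) \<and> (\<omega> \<in> A \<longrightarrow> X \<omega> \<ge> c)"
proof -
  \<comment> \<open>\<open>e B\<close> is the expected score with decision event \<open>B\<close> as
    a real number; its nonnegativity lets an inequality in \<open>ennreal\<close> be read back in
    the reals.\<close>
  define e where "e B = (\<integral>\<omega>. (Z \<omega> - c) * indicator E \<omega> \<partial>M) - (\<integral>\<omega>. (Z \<omega> - c) * indicator B \<omega> \<partial>M)" for B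
  have score: "(\<integral>\<^sup>+\<omega>. ennreal (r \<omega>) \<partial>M) = ennreal (e B) \<and> 0 \<le> e B"
    if "B \<in> sets M" "\<And>\<omega>. \<omega> \<in> space M \<Longrightarrow> r \<omega> = (Z \<omega> - c) * (indicator E \<omega> - indicator B \<omega>)" "\<And>\<omega>. 0 \<le> r \<omega>"
    for r B
  proof -
    have i: "integrable M (\<lambda>\<omega>. (Z \<omega> - c) * indicator B' \<omega>)" if "B' \<in> sets M" for B'
      using opt that by (intro integrable_shift_indicator) (auto simp: optimal_level_set_def)
    have r: "integrable M r"
      using i[OF E] i[OF that(1)]
      by (subst Bochner_Integration.integrable_cong[OF refl that(2)]) (auto simp: right_diff_distrib)
    have e: "integral\<^sup>L M r = e B"
      using i[OF E] i[OF that(1)] unfolding e_def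
      by (subst Bochner_Integration.integral_cong[OF refl that(2)]) (auto simp: right_diff_distrib)
    have "0 \<le> integral\<^sup>L M r" using that(3) by simp
    moreover have "(\<integral>\<^sup>+\<omega>. ennreal (r \<omega>) \<partial>M) = ennreal (integral\<^sup>L M r)"
      using r that(3) by (intro nn_integral_eq_integral) auto
    ultimately show ?thesis unfolding e by blast
  qed
  have U: "U \<in> sets M" using opt by (simp add: optimal_level_set_def)
  have eU: "(\<integral>\<^sup>+\<omega>. ennreal (s \<omega>) \<partial>M) = ennreal (e U)" "0 \<le> e U"
    using score[OF U s nonneg(1)] by auto
  have eA: "(\<integral>\<^sup>+\<omega>. ennreal (t \<omega>) \<partial>M) = ennreal (e A)"
    using score[OF A(2) t nonneg(2)] by auto
  have "e U \<le> e A"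
    using optimal_level_set_le[OF opt A] by (simp add: e_def)
  then show "(\<integral>\<^sup>+\<omega>. ennreal (s \<omega>) \<partial>M) \<le> (\<integral>\<^sup>+\<omega>. ennreal (t \<omega>) \<partial>M)"
    unfolding eU eA by (rule ennreal_leI)
  assume "(\<integral>\<^sup>+\<omega>. ennreal (t \<omega>) \<partial>M) \<le> (\<integral>\<^sup>+\<omega>. ennreal (s \<omega>) \<partial>M)"
  then have "ennreal (e A) \<le> ennreal (e U)"
    by (simp only: eU eA)
  then have "e A \<le> e U"
    by (simp only: ennreal_le_iff[OF eU(2)])
  then show "AE \<omega> in M. (X \<omega> > c \<longrightarrow> \<omega> \<in> A) \<and> (\<omega> \<in> A \<longrightarrow> X \<omega> \<ge> c)"
    by (intro optimal_level_set_AE[OF opt A]) (simp add: e_def)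
qed

text \<open>Strict and non-strict level sets of \<open>X\<close> both belong to the \<sigma>-algebra
  generated by \<open>X\<close>, where the defining equality holds. The strict ones serve the events
  given by tail probabilities, the others the comparison of a mean report with its
  threshold.\<close>

lemma is_cond_exp_optimal:
  assumes "is_cond_exp M \<A> Z X"
  shows is_cond_exp_optimal_gt: "optimal_level_set M \<A> Z X c {\<omega> \<in> space M. X \<omega> > c}"
    and is_cond_exp_optimal_ge: "optimal_level_set M \<A> Z X c {\<omega> \<in> space M. X \<omega> \<ge> c}"
proof -
  have Z: "integrable M Z" and X: "integrable M X"
    and le: "\<And>A. A \<in> \<A> \<Longrightarrow> (\<integral>\<omega>. Z \<omega> * indicator A \<omega> \<partial>M) \<le> (\<integral>\<omega>. X \<omega> * indicator A \<omega> \<partial>M)"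
    and eq: "\<And>B. B \<in> sets (vimage_algebra (space M) X borel) \<Longrightarrow>
      (\<integral>\<omega>. X \<omega> * indicator B \<omega> \<partial>M) = (\<integral>\<omega>. Z \<omega> * indicator B \<omega> \<partial>M)"
    using assms by (auto simp: is_cond_exp_def)
  have [measurable]: "X \<in> borel_measurable M" using X by simp
  have "{\<omega> \<in> space M. X \<omega> > c} = X -` {c<..} \<inter> space M"
    "{\<omega> \<in> space M. X \<omega> \<ge> c} = X -` {c..} \<inter> space M" by auto
  then have "{\<omega> \<in> space M. X \<omega> > c} \<in> sets (vimage_algebra (space M) X borel)"
    "{\<omega> \<in> space M. X \<omega> \<ge> c} \<in> sets (vimage_algebra (space M) X borel)"
    by (simp_all add: in_vimage_algebra)
  note this[THEN eq]
  then show "optimal_level_set M \<A> Z X c {\<omega> \<in> space M. X \<omega> > c}"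
    "optimal_level_set M \<A> Z X c {\<omega> \<in> space M. X \<omega> \<ge> c}"
    using Z X le by (auto simp: optimal_level_set_def)
qed

text \<open>The \<open>\<sigma>\<close>-algebras generated by \<open>P(Y > z | \<A>)\<close> vary with \<open>z\<close>, but their level sets decrease to
  the level set of the quantile as \<open>z\<close> increases to \<open>\<eta>\<close>, so the equality on them passes to the limit.\<close>

lemma ICL_quantile_optimal:
  assumes [measurable]: "Y \<in> borel_measurable M" and icl: "is_ICL M \<A> Y P"
    and \<alpha>: "0 < \<alpha>" "\<alpha> < 1" and \<A>: "\<A> \<subseteq> sets M"
  shows "optimal_level_set M \<A> (indicator {\<omega> \<in> space M. \<eta> \<le> Y \<omega>}) (\<lambda>\<omega>. measure (P \<omega>) {\<eta>..}) (1 - \<alpha>)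
    {\<omega> \<in> space M. \<eta> \<le> quantile (cdf (P \<omega>)) \<alpha>}"
proof -
  have P [measurable]: "P \<in> M \<rightarrow>\<^sub>M prob_algebra borel"
    and cp: "\<And>y. is_cond_exp M \<A> (indicator {\<omega> \<in> space M. Y \<omega> > y}) (\<lambda>\<omega>. measure (P \<omega>) {y<..})"
    using icl by (auto simp: is_ICL_def is_cond_prob_def)
  \<comment> \<open>This sequence increases strictly to \<eta> from below, so the open half-lines
    above \<open>z n\<close>, for which conditional probabilities are given, decrease to
    \<open>{\<eta>..}\<close>.\<close>
  define z where "z n = \<eta> - 1 / real (Suc n)" for n
  have z: "z n < \<eta>" for n by (simp add: z_def)
  have z_mono: "z m \<le> z n" if "m \<le> n" for m n
    using that by (simp add: z_def frac_le)
  have z_ex: "\<exists>n. y < z n" if y: "y < \<eta>" for y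
  proof -
    obtain n where "1 / real (Suc n) < \<eta> - y"
      using y nat_approx_posE[of "\<eta> - y"] by auto
    then show ?thesis by (intro exI[of _ n]) (simp add: z_def)
  qed
  have ge_iff: "\<eta> \<le> y \<longleftrightarrow> (\<forall>n. z n < y)" for y
    using z z_ex by (meson less_le_trans less_asym not_le)
  let ?Zn = "\<lambda>n. indicator {\<omega> \<in> space M. Y \<omega> > z n} :: 'a \<Rightarrow> real"
  let ?Z = "indicator {\<omega> \<in> space M. \<eta> \<le> Y \<omega>} :: 'a \<Rightarrow> real"
  let ?Xn = "\<lambda>n \<omega>. measure (P \<omega>) {z n<..}" and ?X = "\<lambda>\<omega>. measure (P \<omega>) {\<eta>..}"
  let ?Un = "\<lambda>n. {\<omega> \<in> space M. 1 - \<alpha> < ?Xn n \<omega>}"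
  let ?U = "{\<omega> \<in> space M. \<eta> \<le> quantile (cdf (P \<omega>)) \<alpha>}"
  have real_dist: "real_distribution (P \<omega>)" if "\<omega> \<in> space M" for \<omega>
    by (rule kernel_real_distribution[OF P that])
  \<comment> \<open>By the Galois connection the level sets of different conditional probabilities
    are superlevel sets of one and the same quantile, so their intersection is
    \<open>?U\<close>.\<close>
  have Un_iff: "1 - \<alpha> < ?Xn n \<omega> \<longleftrightarrow> z n < quantile (cdf (P \<omega>)) \<alpha>" if "\<omega> \<in> space M" for n \<omega>
    using real_distribution.less_quantile_iff[OF real_dist[OF that] \<alpha>, of "z n"]
      real_distribution.cdf_eq_upper[OF real_dist[OF that], of "z n"] by linarith
  have U: "(\<Inter>n. ?Un n) = ?U"
    using Un_iff ge_iff by auto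
  have [measurable]: "?U \<in> sets M"
    unfolding U[symmetric] by measurable
  have lim_Z: "(\<lambda>n. ?Zn n \<omega>) \<longlonglongrightarrow> ?Z \<omega>" for \<omega>
  proof -
    have "(\<Inter>n. {\<omega> \<in> space M. Y \<omega> > z n}) = {\<omega> \<in> space M. \<eta> \<le> Y \<omega>}"
      using ge_iff by auto
    moreover have "decseq (\<lambda>n. {\<omega> \<in> space M. Y \<omega> > z n})"
      using z_mono by (force simp: decseq_def)
    ultimately show ?thesis
      using LIMSEQ_indicator_decseq[of "\<lambda>n. {\<omega> \<in> space M. Y \<omega> > z n}" \<omega>] by simp
  qed
  have lim_U: "(\<lambda>n. indicator (?Un n) \<omega> :: real) \<longlonglongrightarrow> indicator ?U \<omega>" for \<omega>
  proof -
    have "decseq ?Un"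
      using z_mono Un_iff by (force simp: decseq_def)
    then show ?thesis
      using LIMSEQ_indicator_decseq[of ?Un \<omega>] U by simp
  qed
  have lim_X: "(\<lambda>n. ?Xn n \<omega>) \<longlonglongrightarrow> ?X \<omega>" if "\<omega> \<in> space M" for \<omega>
  proof -
    interpret R: real_distribution "P \<omega>" by (rule real_dist[OF that])
    have "decseq (\<lambda>n. {z n<..})"
      using z_mono by (force simp: decseq_def)
    moreover have "(\<Inter>n. {z n<..}) = {\<eta>..}" using ge_iff by auto
    ultimately show ?thesis
      using R.finite_Lim_measure_decseq[of "\<lambda>n. {z n<..}"] by (simp add: image_subset_iff)
  qed
  have X_bound: "measure (P \<omega>) B \<le> 1" if "\<omega> \<in> space M" for B \<omega>
  proof -
    interpret R: real_distribution "P \<omega>" by (rule real_dist[OF that])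
    show ?thesis by simp
  qed
  \<comment> \<open>All factors used below are indicators or probabilities and so bounded by 1,
    which is the dominating function for the products.\<close>
  have lim: "(\<lambda>n. \<integral>\<omega>. f n \<omega> * g n \<omega> \<partial>M) \<longlonglongrightarrow> (\<integral>\<omega>. f' \<omega> * g' \<omega> \<partial>M)"
    if [measurable]: "\<And>n. f n \<in> borel_measurable M" "\<And>n. g n \<in> borel_measurable M"
      "f' \<in> borel_measurable M" "g' \<in> borel_measurable M"
    and "\<And>\<omega>. \<omega> \<in> space M \<Longrightarrow> (\<lambda>n. f n \<omega>) \<longlonglongrightarrow> f' \<omega>" "\<And>\<omega>. \<omega> \<in> space M \<Longrightarrow> (\<lambda>n. g n \<omega>) \<longlonglongrightarrow> g' \<omega>"
    and "\<And>n \<omega>. \<omega> \<in> space M \<Longrightarrow> \<bar>f n \<omega>\<bar> \<le> 1" "\<And>n \<omega>. \<omega> \<in> space M \<Longrightarrow> \<bar>g n \<omega>\<bar> \<le> 1"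
    for f g :: "nat \<Rightarrow> 'a \<Rightarrow> real" and f' g' :: "'a \<Rightarrow> real"
  proof (rule integral_dominated_convergence[where w = "\<lambda>_. 1"])
    show "AE \<omega> in M. (\<lambda>n. f n \<omega> * g n \<omega>) \<longlonglongrightarrow> f' \<omega> * g' \<omega>"
      using that(5,6) by (intro AE_I2 tendsto_mult)
    show "AE \<omega> in M. norm (f n \<omega> * g n \<omega>) \<le> 1" for n
      using that(7,8) by (intro AE_I2) (auto simp: abs_mult intro: mult_le_one)
  qed auto
  have "(\<integral>\<omega>. ?Z \<omega> * indicator A \<omega> \<partial>M) \<le> (\<integral>\<omega>. ?X \<omega> * indicator A \<omega> \<partial>M)" if "A \<in> \<A>" for A
  proof (rule LIMSEQ_le)
    have [measurable]: "A \<in> sets M" using \<A> that by auto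
    show "(\<lambda>n. \<integral>\<omega>. ?Zn n \<omega> * indicator A \<omega> \<partial>M) \<longlonglongrightarrow> (\<integral>\<omega>. ?Z \<omega> * indicator A \<omega> \<partial>M)"
      by (rule lim) (auto intro: lim_Z simp: abs_indicator)
    show "(\<lambda>n. \<integral>\<omega>. ?Xn n \<omega> * indicator A \<omega> \<partial>M) \<longlonglongrightarrow> (\<integral>\<omega>. ?X \<omega> * indicator A \<omega> \<partial>M)"
      by (rule lim) (auto intro: lim_X X_bound simp: abs_indicator)
    show "\<exists>N. \<forall>n\<ge>N. (\<integral>\<omega>. ?Zn n \<omega> * indicator A \<omega> \<partial>M) \<le> (\<integral>\<omega>. ?Xn n \<omega> * indicator A \<omega> \<partial>M)"
      using cp that by (auto simp: is_cond_exp_def)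
  qed
  moreover have "(\<integral>\<omega>. ?X \<omega> * indicator ?U \<omega> \<partial>M) = (\<integral>\<omega>. ?Z \<omega> * indicator ?U \<omega> \<partial>M)"
  proof (rule LIMSEQ_unique)
    show "(\<lambda>n. \<integral>\<omega>. ?Xn n \<omega> * indicator (?Un n) \<omega> \<partial>M) \<longlonglongrightarrow> (\<integral>\<omega>. ?X \<omega> * indicator ?U \<omega> \<partial>M)"
      by (rule lim) (auto intro: lim_X lim_U X_bound simp: abs_indicator)
    have "(\<lambda>n. \<integral>\<omega>. ?Zn n \<omega> * indicator (?Un n) \<omega> \<partial>M) \<longlonglongrightarrow> (\<integral>\<omega>. ?Z \<omega> * indicator ?U \<omega> \<partial>M)"
      by (rule lim) (auto intro: lim_Z lim_U simp: abs_indicator)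
    \<comment> \<open>Each \<open>?Un n\<close> is a strict level set of the conditional probability
      \<open>?Xn n\<close>, and there the defining equality is available.\<close>
    moreover have "(\<integral>\<omega>. ?Xn n \<omega> * indicator (?Un n) \<omega> \<partial>M) = (\<integral>\<omega>. ?Zn n \<omega> * indicator (?Un n) \<omega> \<partial>M)" for n
      using is_cond_exp_optimal_gt[OF cp] by (simp add: optimal_level_set_def)
    ultimately show "(\<lambda>n. \<integral>\<omega>. ?Xn n \<omega> * indicator (?Un n) \<omega> \<partial>M) \<longlonglongrightarrow> (\<integral>\<omega>. ?Z \<omega> * indicator ?U \<omega> \<partial>M)"
      by simp
  qed
  moreover have "(1 - \<alpha> < ?X \<omega> \<longrightarrow> \<omega> \<in> ?U) \<and> (\<omega> \<in> ?U \<longrightarrow> 1 - \<alpha> \<le> ?X \<omega>)" if "\<omega> \<in> space M" for \<omega>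
  proof -
    interpret R: real_distribution "P \<omega>" by (rule real_dist[OF that])
    \<comment> \<open>\<open>{\<eta>..}\<close> lies in every \<open>{z n<..}\<close>, so a level
      exceeded by \<open>?X \<omega>\<close> is exceeded by all
      \<open>?Xn n \<omega>\<close>.\<close>
    have "?X \<omega> \<le> ?Xn n \<omega>" for n
      using z by (intro R.finite_measure_mono) (auto intro: less_le_trans)
    then have "\<omega> \<in> ?U" if "1 - \<alpha> < ?X \<omega>"
      using that \<open>\<omega> \<in> space M\<close> by (subst U[symmetric]) (auto intro: less_le_trans)
    moreover have "1 - \<alpha> \<le> ?X \<omega>" if "\<omega> \<in> ?U"
      using that R.upper_measure_ge[OF \<alpha>] by simp
    ultimately show ?thesis by blast
  qed
  moreover have "integrable M ?X"
    by (rule integrable_const_bound[where B = 1]) (use X_bound in auto)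
  ultimately show ?thesis
    unfolding optimal_level_set_def by (auto simp: less_top[symmetric])
qed

section \<open>Optimality of the conditional law under one elementary score\<close>

lemma threshold_score:
  assumes [measurable]: "Y \<in> borel_measurable M" and icl: "is_ICL M \<A> Y P" and \<A>: "\<A> \<subseteq> sets M"
    and G: "lattice_kernel M \<A> G"
  shows threshold_score_le:
      "(\<integral>\<^sup>+\<omega>. ennreal (score_E \<eta> (cdf (P \<omega>) z) (of_bool (Y \<omega> \<le> z))) \<partial>M)
        \<le> (\<integral>\<^sup>+\<omega>. ennreal (score_E \<eta> (cdf (G \<omega>) z) (of_bool (Y \<omega> \<le> z))) \<partial>M)"
    and threshold_score_AE:
      "(\<integral>\<^sup>+\<omega>. ennreal (score_E \<eta> (cdf (G \<omega>) z) (of_bool (Y \<omega> \<le> z))) \<partial>M)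
        \<le> (\<integral>\<^sup>+\<omega>. ennreal (score_E \<eta> (cdf (P \<omega>) z) (of_bool (Y \<omega> \<le> z))) \<partial>M) \<Longrightarrow>
      AE \<omega> in M. (measure (P \<omega>) {z<..} > 1 - \<eta> \<longrightarrow> measure (G \<omega>) {z..} \<ge> 1 - \<eta>) \<and>
        (measure (G \<omega>) {z<..} > 1 - \<eta> \<longrightarrow> measure (P \<omega>) {z..} \<ge> 1 - \<eta>)"
proof -
  have P: "P \<in> M \<rightarrow>\<^sub>M prob_algebra borel"
    and cp: "is_cond_exp M \<A> (indicator {\<omega> \<in> space M. Y \<omega> > z}) (\<lambda>\<omega>. measure (P \<omega>) {z<..})"
    using icl by (auto simp: is_ICL_def is_cond_prob_def)
  have G': "G \<in> M \<rightarrow>\<^sub>M prob_algebra borel"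
    using G by (simp add: lattice_kernel_def)
  let ?A = "\<lambda>G. {\<omega> \<in> space M. measure (G \<omega> :: real measure) {z<..} > 1 - \<eta>}"
  have A: "?A G \<in> \<A>" "?A G \<in> sets M"
    using G \<A> by (auto simp: lattice_kernel_def lattice_measurable_def)
  have E: "{\<omega> \<in> space M. \<not> \<eta> \<le> of_bool (Y \<omega> \<le> z)} \<in> sets M"
    by measurable
  \<comment> \<open>Passing from the cdf to tail probabilities replaces both events of the
    factorization by their complements, which reverses the sign of their difference, and turns the
    level \<eta> into \<open>c = 1 - \<eta>\<close>. The complement of a non-strict inequality is
    strict, whence the strict level set.\<close>
  have score: "score_E \<eta> (cdf (K \<omega>) z) (of_bool (Y \<omega> \<le> z)) =
      (indicator {\<omega> \<in> space M. Y \<omega> > z} \<omega> - (1 - \<eta>)) *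
      (indicator {\<omega> \<in> space M. \<not> \<eta> \<le> of_bool (Y \<omega> \<le> z)} \<omega> - indicator (?A K) \<omega>)"
    if "K \<in> M \<rightarrow>\<^sub>M prob_algebra borel" "\<omega> \<in> space M" for K \<omega>
    using real_distribution.cdf_eq_upper[OF kernel_real_distribution[OF that]] that(2)
    by (auto simp: score_E_eq indicator_def of_bool_def)
  note * = is_cond_exp_optimal_gt[OF cp] A E score[OF P] score[OF G'] score_E_nonneg score_E_nonneg
  show "(\<integral>\<^sup>+\<omega>. ennreal (score_E \<eta> (cdf (P \<omega>) z) (of_bool (Y \<omega> \<le> z))) \<partial>M)
        \<le> (\<integral>\<^sup>+\<omega>. ennreal (score_E \<eta> (cdf (G \<omega>) z) (of_bool (Y \<omega> \<le> z))) \<partial>M)"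
    by (rule expected_score_le[OF *])
  assume le: "(\<integral>\<^sup>+\<omega>. ennreal (score_E \<eta> (cdf (G \<omega>) z) (of_bool (Y \<omega> \<le> z))) \<partial>M)
        \<le> (\<integral>\<^sup>+\<omega>. ennreal (score_E \<eta> (cdf (P \<omega>) z) (of_bool (Y \<omega> \<le> z))) \<partial>M)"
  have "AE \<omega> in M. (measure (P \<omega>) {z<..} > 1 - \<eta> \<longrightarrow> \<omega> \<in> ?A G) \<and>
      (\<omega> \<in> ?A G \<longrightarrow> measure (P \<omega>) {z<..} \<ge> 1 - \<eta>)"
    by (rule expected_score_AE[OF * le])
  then show "AE \<omega> in M. (measure (P \<omega>) {z<..} > 1 - \<eta> \<longrightarrow> measure (G \<omega>) {z..} \<ge> 1 - \<eta>) \<and>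
        (measure (G \<omega>) {z<..} > 1 - \<eta> \<longrightarrow> measure (P \<omega>) {z..} \<ge> 1 - \<eta>)"
  proof (rule AE_mp, intro AE_I2 impI)
    fix \<omega> assume \<omega>: "\<omega> \<in> space M"
      and ae: "(measure (P \<omega>) {z<..} > 1 - \<eta> \<longrightarrow> \<omega> \<in> ?A G) \<and>
        (\<omega> \<in> ?A G \<longrightarrow> measure (P \<omega>) {z<..} \<ge> 1 - \<eta>)"
    have "measure (K \<omega>) {z<..} \<le> measure (K \<omega>) {z..}"
      if "K \<in> M \<rightarrow>\<^sub>M prob_algebra borel" for K
    proof -
      interpret K: real_distribution "K \<omega>" by (rule kernel_real_distribution[OF that \<omega>])
      show ?thesis by (intro K.finite_measure_mono) auto
    qed
    from this[OF P] this[OF G'] ae \<omega>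
    show "(measure (P \<omega>) {z<..} > 1 - \<eta> \<longrightarrow> measure (G \<omega>) {z..} \<ge> 1 - \<eta>) \<and>
        (measure (G \<omega>) {z<..} > 1 - \<eta> \<longrightarrow> measure (P \<omega>) {z..} \<ge> 1 - \<eta>)"
      by auto
  qed
qed

text \<open>The report itself is compared with \<eta>, so \<open>c = \<eta>\<close> and the decision
  event is a non-strict superlevel set.\<close>

lemma mean_score_elementary_le:
  assumes cp: "is_cond_prob M \<A> {\<omega> \<in> space M. Q \<omega>} X" and [measurable]: "Measurable.pred M Q"
    and \<A>: "sigma_lattice M \<A>" and V: "lattice_measurable M \<A> V"
  shows "(\<integral>\<^sup>+\<omega>. ennreal (score_E \<eta> (X \<omega>) (of_bool (Q \<omega>))) \<partial>M)
        \<le> (\<integral>\<^sup>+\<omega>. ennreal (score_E \<eta> (V \<omega>) (of_bool (Q \<omega>))) \<partial>M)"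
proof (rule expected_score_le)
  show "optimal_level_set M \<A> (indicator {\<omega> \<in> space M. Q \<omega>}) X \<eta> {\<omega> \<in> space M. X \<omega> \<ge> \<eta>}"
    using cp unfolding is_cond_prob_def by (rule is_cond_exp_optimal_ge)
  show "{\<omega> \<in> space M. V \<omega> \<ge> \<eta>} \<in> \<A>"
    using \<A> V by (rule lattice_measurable_ge)
  then show "{\<omega> \<in> space M. V \<omega> \<ge> \<eta>} \<in> sets M"
    using \<A> by (auto simp: sigma_lattice_def)
  show "{\<omega> \<in> space M. \<eta> \<le> of_bool (Q \<omega>)} \<in> sets M"
    by measurable
qed (auto simp: score_E_nonneg score_E_eq indicator_def of_bool_def)

text \<open>In the factorized score both \<open>Z\<close> and \<open>E\<close> come from the event
  that \<eta> is at most \<open>Y\<close>, and \<open>c = 1 - \<alpha>\<close>. The optimal event is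
  the superlevel set of the quantile of \<open>P\<close>; a competitor contributes the corresponding
  set for \<open>V\<close>.\<close>

lemma quantile_score_optimal:
  assumes [measurable]: "Y \<in> borel_measurable M" and icl: "is_ICL M \<A> Y P"
    and \<A>: "sigma_lattice M \<A>" and \<alpha>: "0 < \<alpha>" "\<alpha> < 1" and V: "lattice_measurable M \<A> V"
  shows quantile_score_le:
      "(\<integral>\<^sup>+\<omega>. ennreal (score_Q \<alpha> \<eta> (quantile (cdf (P \<omega>)) \<alpha>) (Y \<omega>)) \<partial>M)
        \<le> (\<integral>\<^sup>+\<omega>. ennreal (score_Q \<alpha> \<eta> (V \<omega>) (Y \<omega>)) \<partial>M)"
    and quantile_score_AE:
      "(\<integral>\<^sup>+\<omega>. ennreal (score_Q \<alpha> \<eta> (V \<omega>) (Y \<omega>)) \<partial>M)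
        \<le> (\<integral>\<^sup>+\<omega>. ennreal (score_Q \<alpha> \<eta> (quantile (cdf (P \<omega>)) \<alpha>) (Y \<omega>)) \<partial>M) \<Longrightarrow>
      AE \<omega> in M. (measure (P \<omega>) {\<eta>..} > 1 - \<alpha> \<longrightarrow> \<eta> \<le> V \<omega>) \<and>
        (\<eta> \<le> V \<omega> \<longrightarrow> measure (P \<omega>) {\<eta>..} \<ge> 1 - \<alpha>)"
proof -
  have \<A>': "\<A> \<subseteq> sets M" using \<A> by (simp add: sigma_lattice_def)
  have A: "{\<omega> \<in> space M. \<eta> \<le> V \<omega>} \<in> \<A>"
    using \<A> V by (rule lattice_measurable_ge)
  have E: "{\<omega> \<in> space M. \<eta> \<le> Y \<omega>} \<in> sets M"
    by measurable
  have score: "score_Q \<alpha> \<eta> (f \<omega>) (Y \<omega>) = (indicator {\<omega> \<in> space M. \<eta> \<le> Y \<omega>} \<omega> - (1 - \<alpha>)) *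
      (indicator {\<omega> \<in> space M. \<eta> \<le> Y \<omega>} \<omega> - indicator {\<omega> \<in> space M. \<eta> \<le> f \<omega>} \<omega>)"
    if "\<omega> \<in> space M" for f \<omega>
    using that by (auto simp: score_Q_eq indicator_def of_bool_def)
  note * = ICL_quantile_optimal[OF assms(1) icl \<alpha> \<A>', of \<eta>] A subsetD[OF \<A>' A] E score score
    score_Q_nonneg[OF \<alpha>] score_Q_nonneg[OF \<alpha>]
  show "(\<integral>\<^sup>+\<omega>. ennreal (score_Q \<alpha> \<eta> (quantile (cdf (P \<omega>)) \<alpha>) (Y \<omega>)) \<partial>M)
        \<le> (\<integral>\<^sup>+\<omega>. ennreal (score_Q \<alpha> \<eta> (V \<omega>) (Y \<omega>)) \<partial>M)"
    by (rule expected_score_le[OF *])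
  assume le: "(\<integral>\<^sup>+\<omega>. ennreal (score_Q \<alpha> \<eta> (V \<omega>) (Y \<omega>)) \<partial>M)
        \<le> (\<integral>\<^sup>+\<omega>. ennreal (score_Q \<alpha> \<eta> (quantile (cdf (P \<omega>)) \<alpha>) (Y \<omega>)) \<partial>M)"
  have "AE \<omega> in M. (measure (P \<omega>) {\<eta>..} > 1 - \<alpha> \<longrightarrow> \<omega> \<in> {\<omega> \<in> space M. \<eta> \<le> V \<omega>}) \<and>
        (\<omega> \<in> {\<omega> \<in> space M. \<eta> \<le> V \<omega>} \<longrightarrow> measure (P \<omega>) {\<eta>..} \<ge> 1 - \<alpha>)"
    by (rule expected_score_AE[OF * le])
  then show "AE \<omega> in M. (measure (P \<omega>) {\<eta>..} > 1 - \<alpha> \<longrightarrow> \<eta> \<le> V \<omega>) \<and>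
        (\<eta> \<le> V \<omega> \<longrightarrow> measure (P \<omega>) {\<eta>..} \<ge> 1 - \<alpha>)"
    by (rule AE_mp) (intro AE_I2, auto)
qed

subsection \<open>Mixtures and uniqueness\<close>

text \<open>Tonelli's theorem moves the expectation inside the mixture, so a comparison for each
  parameter suffices.\<close>

lemma expected_mixture_le:
  assumes "sigma_finite_measure H"
    and "(\<lambda>(\<omega>, \<theta>). s \<omega> \<theta>) \<in> borel_measurable (M \<Otimes>\<^sub>M H)"
    and "(\<lambda>(\<omega>, \<theta>). t \<omega> \<theta>) \<in> borel_measurable (M \<Otimes>\<^sub>M H)"
    and "\<And>\<theta>. \<theta> \<in> space H \<Longrightarrow> (\<integral>\<^sup>+\<omega>. s \<omega> \<theta> \<partial>M) \<le> (\<integral>\<^sup>+\<omega>. t \<omega> \<theta> \<partial>M)"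
  shows "(\<integral>\<^sup>+\<omega>. \<integral>\<^sup>+\<theta>. s \<omega> \<theta> \<partial>H \<partial>M) \<le> (\<integral>\<^sup>+\<omega>. \<integral>\<^sup>+\<theta>. t \<omega> \<theta> \<partial>H \<partial>M)"
proof -
  interpret H: sigma_finite_measure H by fact
  interpret pair_sigma_finite M H ..
  show ?thesis
    unfolding Fubini'[OF assms(2), symmetric] Fubini'[OF assms(3), symmetric]
    by (rule nn_integral_mono) (rule assms(4))
qed

text \<open>The excess of \<open>t\<close> over \<open>s\<close> at each parameter is nonnegative.
  The total for \<open>s\<close> is finite and can be subtracted, so the excess has integral
  zero.\<close>

lemma expected_mixture_AE:
  assumes "sigma_finite_measure H"
    and s: "(\<lambda>(\<omega>, \<theta>). s \<omega> \<theta>) \<in> borel_measurable (M \<Otimes>\<^sub>M H)"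
    and t: "(\<lambda>(\<omega>, \<theta>). t \<omega> \<theta>) \<in> borel_measurable (M \<Otimes>\<^sub>M H)"
    and le: "\<And>\<theta>. \<theta> \<in> space H \<Longrightarrow> (\<integral>\<^sup>+\<omega>. s \<omega> \<theta> \<partial>M) \<le> (\<integral>\<^sup>+\<omega>. t \<omega> \<theta> \<partial>M)"
    and fin: "(\<integral>\<^sup>+\<omega>. \<integral>\<^sup>+\<theta>. s \<omega> \<theta> \<partial>H \<partial>M) < \<infinity>"
    and ge: "(\<integral>\<^sup>+\<omega>. \<integral>\<^sup>+\<theta>. t \<omega> \<theta> \<partial>H \<partial>M) \<le> (\<integral>\<^sup>+\<omega>. \<integral>\<^sup>+\<theta>. s \<omega> \<theta> \<partial>H \<partial>M)"
  shows "AE \<theta> in H. (\<integral>\<^sup>+\<omega>. t \<omega> \<theta> \<partial>M) \<le> (\<integral>\<^sup>+\<omega>. s \<omega> \<theta> \<partial>M)"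
proof -
  interpret H: sigma_finite_measure H by fact
  interpret pair_sigma_finite M H ..
  let ?s = "\<lambda>\<theta>. \<integral>\<^sup>+\<omega>. s \<omega> \<theta> \<partial>M" and ?t = "\<lambda>\<theta>. \<integral>\<^sup>+\<omega>. t \<omega> \<theta> \<partial>M"
  have [measurable]: "?s \<in> borel_measurable H" "?t \<in> borel_measurable H"
    using s t by measurable
  have fin': "integral\<^sup>N H ?s \<noteq> \<infinity>" and ge': "integral\<^sup>N H ?t \<le> integral\<^sup>N H ?s"
    using fin ge unfolding Fubini'[OF s, symmetric] Fubini'[OF t, symmetric] by auto
  have "(\<integral>\<^sup>+\<theta>. ?t \<theta> - ?s \<theta> \<partial>H) = integral\<^sup>N H ?t - integral\<^sup>N H ?s"
    using fin' le by (intro nn_integral_diff) auto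
  also have "\<dots> = 0"
    using ge' fin' by (intro diff_eq_0_ennreal) (auto simp: less_top)
  finally have "AE \<theta> in H. ?t \<theta> - ?s \<theta> = 0"
    by (subst (asm) nn_integral_0_iff_AE) auto
  moreover have "AE \<theta> in H. ?s \<theta> \<noteq> \<infinity>"
    using fin' by (intro nn_integral_noteq_infinite) auto
  ultimately show ?thesis
    by eventually_elim (simp add: diff_eq_0_iff_ennreal less_top)
qed

text \<open>The comparison of open with closed half-lines is the common weakening of what equality of
  the expected scores yields in the threshold and in the quantile case.\<close>

lemma kernel_AE_eqI:
  assumes P: "P \<in> M \<rightarrow>\<^sub>M prob_algebra borel" and G: "G \<in> M \<rightarrow>\<^sub>M prob_algebra borel"
    and dense: "\<And>a b p q :: real. a < b \<Longrightarrow> 0 \<le> p \<Longrightarrow> p < q \<Longrightarrow> q \<le> 1 \<Longrightarrow>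
      \<exists>x \<in> D. x \<in> {a<..<b} \<times> {p<..<q}"
    and AE: "\<And>z c. (z, c) \<in> D \<Longrightarrow> AE \<omega> in M. (measure (P \<omega>) {z<..} > c \<longrightarrow> measure (G \<omega>) {z..} \<ge> c) \<and>
      (measure (G \<omega>) {z<..} > c \<longrightarrow> measure (P \<omega>) {z..} \<ge> c)"
  shows "kernel_AE_eq M P G"
proof -
  \<comment> \<open>Rational boxes form a countable family. Choosing one point of \<open>D\<close>
    in each valid box leaves countably many almost sure relations, which hold together off one null
    set.\<close>
  let ?box = "\<lambda>(a, b, p, q). {real_of_rat a<..<of_rat b} \<times> {real_of_rat p<..<of_rat q}"
  let ?ok = "\<lambda>(a :: rat, b, p, q). a < b \<and> 0 \<le> p \<and> p < q \<and> q \<le> (1 :: rat)"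
  have "\<forall>r. \<exists>x. ?ok r \<longrightarrow> x \<in> D \<and> x \<in> ?box r"
  proof
    fix r :: "rat \<times> rat \<times> rat \<times> rat"
    obtain a b p q where r: "r = (a, b, p, q)" by (cases r)
    show "\<exists>x. ?ok r \<longrightarrow> x \<in> D \<and> x \<in> ?box r"
      using dense[of "of_rat a" "of_rat b" "of_rat p" "of_rat q"] unfolding r
      by (simp add: of_rat_less Bex_def)
  qed
  from choice[OF this] obtain d where d_all: "\<forall>r. ?ok r \<longrightarrow> d r \<in> D \<and> d r \<in> ?box r" ..
  have d: "d r \<in> D \<and> d r \<in> ?box r" if "?ok r" for r
    by (rule mp[OF spec[OF d_all] that])
  have "AE \<omega> in M. \<forall>r. ?ok r \<longrightarrow>
      (measure (P \<omega>) {fst (d r)<..} > snd (d r) \<longrightarrow> measure (G \<omega>) {fst (d r)..} \<ge> snd (d r)) \<and>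
      (measure (G \<omega>) {fst (d r)<..} > snd (d r) \<longrightarrow> measure (P \<omega>) {fst (d r)..} \<ge> snd (d r))"
  proof (subst AE_all_countable, intro allI AE_impI)
    fix r assume "?ok r"
    then have "(fst (d r), snd (d r)) \<in> D" using d by simp
    then show "AE \<omega> in M. (measure (P \<omega>) {fst (d r)<..} > snd (d r) \<longrightarrow> measure (G \<omega>) {fst (d r)..} \<ge> snd (d r)) \<and>
      (measure (G \<omega>) {fst (d r)<..} > snd (d r) \<longrightarrow> measure (P \<omega>) {fst (d r)..} \<ge> snd (d r))"
      by (rule AE)
  qed
  then have "AE \<omega> in M. P \<omega> = G \<omega>"
  proof (rule AE_mp, intro AE_I2 impI)
    fix \<omega> assume \<omega>: "\<omega> \<in> space M"
      and ae: "\<forall>r. ?ok r \<longrightarrow>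
      (measure (P \<omega>) {fst (d r)<..} > snd (d r) \<longrightarrow> measure (G \<omega>) {fst (d r)..} \<ge> snd (d r)) \<and>
      (measure (G \<omega>) {fst (d r)<..} > snd (d r) \<longrightarrow> measure (P \<omega>) {fst (d r)..} \<ge> snd (d r))"
    \<comment> \<open>The relation between the kernels is symmetric, so one inequality of cdfs, used
      in both directions, gives equality.\<close>
    have le: "cdf N2 z \<le> cdf N1 z"
      if N: "real_distribution N1" "real_distribution N2"
        and *: "\<And>r. ?ok r \<Longrightarrow> measure N1 {fst (d r)<..} > snd (d r) \<Longrightarrow> measure N2 {fst (d r)..} \<ge> snd (d r)"
      for N1 N2 z
    proof (rule ccontr)
      interpret N1: real_distribution N1 by fact
      interpret N2: real_distribution N2 by fact
      assume "\<not> cdf N2 z \<le> cdf N1 z"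
      \<comment> \<open>If the inequality fails, the mass above \<open>z\<close> is smaller under
        \<open>N2\<close> than under \<open>N1\<close>, and rational levels \<open>p < q\<close> fit
        strictly between the two.\<close>
      then obtain q where q: "1 - cdf N2 z < of_rat q" "of_rat q < 1 - cdf N1 z"
        using of_rat_dense[of "1 - cdf N2 z" "1 - cdf N1 z"] by auto
      obtain p where p: "1 - cdf N2 z < of_rat p" "(of_rat p :: real) < of_rat q"
        using of_rat_dense[OF q(1)] by auto
      \<comment> \<open>By right continuity the mass of \<open>N1\<close> above points slightly to
        the right of \<open>z\<close> still exceeds \<open>q\<close>; \<open>a < b\<close> are taken
        in that range.\<close>
      have "(cdf N1 \<longlongrightarrow> cdf N1 z) (at_right z)"
        using N1.cdf_is_right_cont by (simp add: continuous_within)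
      moreover have "cdf N1 z < 1 - of_rat q" using q by simp
      ultimately have "eventually (\<lambda>y. cdf N1 y < 1 - of_rat q) (at_right z)"
        by (rule order_tendstoD(2))
      then obtain b' where b': "b' > z" "\<And>y. z < y \<Longrightarrow> y < b' \<Longrightarrow> cdf N1 y < 1 - of_rat q"
        by (auto simp: eventually_at_right_field)
      obtain b where b: "z < of_rat b" "of_rat b < b'"
        using of_rat_dense[OF b'(1)] by auto
      obtain a where a: "z < of_rat a" "(of_rat a :: real) < of_rat b"
        using of_rat_dense[OF b(1)] by auto
      let ?r = "(a, b, p, q)"
      have "(0 :: real) \<le> of_rat p" "(of_rat q :: real) \<le> 1"
        using p q N2.cdf_bounded_prob[of z] N1.cdf_nonneg[of z] by linarith+
      then have ok: "?ok ?r"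
        using a p by (simp add: of_rat_less)
      obtain y c where yc: "d ?r = (y, c)" by (cases "d ?r")
      have y: "of_rat a < y" "y < of_rat b" "of_rat p < c" "c < of_rat q"
        using d[OF ok] unfolding yc by auto
      \<comment> \<open>At the chosen point of this box \<open>N2\<close> has mass at least
        \<open>c > p\<close> on \<open>{y..}\<close>. As \<open>z < y\<close>, this set lies in
        \<open>{z<..}\<close>, whose mass is below \<open>p\<close>.\<close>
      have "cdf N1 y < 1 - of_rat q"
        using y a b by (intro b') auto
      then have "measure N1 {y<..} > c"
        using N1.cdf_eq_upper[of y] y by simp
      then have "c \<le> measure N2 {y..}"
        using *[OF ok] by (simp add: yc)
      also have "\<dots> \<le> measure N2 {z<..}"
        using y a by (intro N2.finite_measure_mono) auto
      also have "\<dots> < of_rat p"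
        using p N2.cdf_eq_upper[of z] by simp
      finally show False using y by simp
    qed
    have "cdf (P \<omega>) = cdf (G \<omega>)"
      using kernel_real_distribution[OF P \<omega>] kernel_real_distribution[OF G \<omega>] ae
      by (intro ext antisym le) blast+
    then show "P \<omega> = G \<omega>"
      using kernel_real_distribution[OF P \<omega>] kernel_real_distribution[OF G \<omega>]
      by (intro cdf_unique)
  qed
  then show ?thesis
    unfolding kernel_AE_eq_def by (auto elim: AE_mp)
qed

text \<open>A neighbourhood of a support point has positive mass, so it cannot lie in the null set
  where \<open>Q\<close> fails.\<close>

lemma AE_meets_open:
  assumes "AE \<theta> in H. Q \<theta>" "x \<in> measure_support H" "open O'" "x \<in> O'"
  shows "\<exists>\<theta> \<in> O' \<inter> space H. Q \<theta>"
proof (rule ccontr)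
  assume none: "\<not> ?thesis"
  obtain N where N: "{\<theta> \<in> space H. \<not> Q \<theta>} \<subseteq> N" "emeasure H N = 0" "N \<in> sets H"
    using AE_E[OF assms(1)] by blast
  have "emeasure H (O' \<inter> space H) \<le> emeasure H N"
    using N none by (intro emeasure_mono) auto
  moreover have "emeasure H (O' \<inter> space H) > 0"
    using assms by (auto simp: measure_support_def)
  ultimately show False using N by simp
qed

text \<open>Here \<open>\<theta>\<close> is the mixing parameter and \<open>f \<theta> = (z, c)\<close> is the pair at which an elementary score
  tests whether the mass of the kernel above \<open>z\<close> exceeds \<open>c\<close>.\<close>

lemma mixture_rule_optimal:
  fixes s :: "(real \<Rightarrow> real) \<Rightarrow> real \<Rightarrow> real \<times> real \<Rightarrow> ennreal"
    and f :: "real \<times> real \<Rightarrow> real \<times> real"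
  assumes P: "lattice_kernel M \<A> P"
    and S: "\<And>H F y. S H F y = (\<integral>\<^sup>+\<theta>. s F y \<theta> \<partial>H)"
    and meas: "\<And>G. lattice_kernel M \<A> G \<Longrightarrow>
      (\<lambda>(\<omega>, \<theta>). s (cdf (G \<omega>)) (Y \<omega>) \<theta>) \<in> borel_measurable (M \<Otimes>\<^sub>M restrict_space borel D)"
    and le: "\<And>G \<theta>. lattice_kernel M \<A> G \<Longrightarrow> \<theta> \<in> D \<Longrightarrow>
      (\<integral>\<^sup>+\<omega>. s (cdf (P \<omega>)) (Y \<omega>) \<theta> \<partial>M) \<le> (\<integral>\<^sup>+\<omega>. s (cdf (G \<omega>)) (Y \<omega>) \<theta> \<partial>M)"
    and AE: "\<And>G \<theta> z c. lattice_kernel M \<A> G \<Longrightarrow> \<theta> \<in> D \<Longrightarrow> f \<theta> = (z, c) \<Longrightarrow>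
      (\<integral>\<^sup>+\<omega>. s (cdf (G \<omega>)) (Y \<omega>) \<theta> \<partial>M) \<le> (\<integral>\<^sup>+\<omega>. s (cdf (P \<omega>)) (Y \<omega>) \<theta> \<partial>M) \<Longrightarrow>
      AE \<omega> in M. (measure (P \<omega>) {z<..} > c \<longrightarrow> measure (G \<omega>) {z..} \<ge> c) \<and>
        (measure (G \<omega>) {z<..} > c \<longrightarrow> measure (P \<omega>) {z..} \<ge> c)"
    and W: "W \<subseteq> D" and f: "continuous_on UNIV f" and fW: "UNIV \<times> {0<..<1} \<subseteq> f ` W"
  shows mixture_rule_arg_min: "sigma_finite_borel_on D H \<Longrightarrow>
      is_arg_min (expected_rule M Y (S H)) (lattice_kernel M \<A>) P"
    and mixture_rule_unique: "unique_minimizer M \<A> Y D W S P"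
proof -
  have meas': "(\<lambda>(\<omega>, \<theta>). s (cdf (G \<omega>)) (Y \<omega>) \<theta>) \<in> borel_measurable (M \<Otimes>\<^sub>M H)"
    if "sigma_finite_borel_on D H" "lattice_kernel M \<A> G" for H G
  proof -
    have "sets (M \<Otimes>\<^sub>M H) = sets (M \<Otimes>\<^sub>M restrict_space borel D)"
      using that(1) by (intro sets_pair_measure_cong) (auto simp: sigma_finite_borel_on_def)
    with meas[OF that(2)] show ?thesis by (simp cong: measurable_cong_sets)
  qed
  have space: "space H = D" if "sigma_finite_borel_on D H" for H
    using that sets_eq_imp_space_eq[of H "restrict_space borel D"]
    by (simp add: sigma_finite_borel_on_def space_restrict_space)
  show min: "is_arg_min (expected_rule M Y (S H)) (lattice_kernel M \<A>) P"
    if H: "sigma_finite_borel_on D H" for H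
  proof -
    have "expected_rule M Y (S H) P \<le> expected_rule M Y (S H) G" if G: "lattice_kernel M \<A> G" for G
      unfolding expected_rule_def S
      using H le[OF G] by (intro expected_mixture_le meas' P G) (auto simp: sigma_finite_borel_on_def space[OF H])
    with P show ?thesis by (auto simp: is_arg_min_def not_less)
  qed
  have kernel: "G \<in> M \<rightarrow>\<^sub>M prob_algebra borel" if "lattice_kernel M \<A> G" for G
    using that by (simp add: lattice_kernel_def)
  \<comment> \<open>The image of \<open>W\<close> under \<open>f\<close> covers every threshold with
    every level in (0,1), so it meets each such box.\<close>
  have box: "\<exists>x \<in> W. f x \<in> {a<..<b} \<times> {p<..<q}" if ord: "a < b" "0 \<le> p" "p < q" "q \<le> 1" for a b p q
  proof -
    obtain z c where "a < z" "z < b" "p < c" "c < q"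
      using ord dense by metis
    then have zc: "(z, c) \<in> {a<..<b} \<times> {p<..<q}" and "(z, c) \<in> f ` W"
      using ord fW by auto
    then obtain x where "x \<in> W" "f x = (z, c)" by auto
    with zc show ?thesis by (intro bexI[of _ x]) auto
  qed
  have all_H: "kernel_AE_eq M P G"
    if G_min: "\<And>H. sigma_finite_borel_on D H \<Longrightarrow>
      is_arg_min (expected_rule M Y (S H)) (lattice_kernel M \<A>) G" for G
  proof (rule kernel_AE_eqI[where D = "f ` W"])
    \<comment> \<open>Being a minimizer includes membership in the class of kernels; the null
      measure is an admissible mixing measure from which to read this off.\<close>
    have "sigma_finite_borel_on D (null_measure (restrict_space borel D))"
      by (auto simp: sigma_finite_borel_on_def intro!: finite_measure.axioms finite_measureI)
    from G_min[OF this] have G: "lattice_kernel M \<A> G"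
      by (simp add: is_arg_min_def)
    show "P \<in> M \<rightarrow>\<^sub>M prob_algebra borel" "G \<in> M \<rightarrow>\<^sub>M prob_algebra borel"
      using P G kernel by auto
    show "\<exists>x \<in> f ` W. x \<in> {a<..<b} \<times> {p<..<q}" if "a < b" "0 \<le> p" "p < q" "q \<le> 1" for a b p q :: real
      using box[OF that] by auto
    fix z c assume "(z, c) \<in> f ` W"
    then obtain \<theta> where \<theta>: "\<theta> \<in> W" "f \<theta> = (z, c)" by auto
    have \<theta>D: "\<theta> \<in> D" using \<theta> W by auto
    \<comment> \<open>A point mass at \<theta> reduces the rule to the elementary score at \<theta>,
      so a common minimizer is tested at each parameter separately.\<close>
    let ?H = "return (restrict_space borel D) \<theta>"
    have "prob_space ?H"
      using \<theta>D by (intro prob_space_return) (simp add: space_restrict_space)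
    then have "sigma_finite_borel_on D ?H"
      by (auto simp: sigma_finite_borel_on_def dest: prob_space_imp_sigma_finite)
    from G_min[OF this] P
    have "expected_rule M Y (S ?H) G \<le> expected_rule M Y (S ?H) P"
      by (auto simp: is_arg_min_def not_less)
    moreover have "expected_rule M Y (S ?H) K = (\<integral>\<^sup>+\<omega>. s (cdf (K \<omega>)) (Y \<omega>) \<theta> \<partial>M)"
      if "lattice_kernel M \<A> K" for K
      unfolding expected_rule_def S
    proof (rule nn_integral_cong)
      fix \<omega> assume "\<omega> \<in> space M"
      then have "(\<lambda>\<theta>. s (cdf (K \<omega>)) (Y \<omega>) \<theta>) \<in> borel_measurable (restrict_space borel D)"
        using measurable_compose[OF measurable_Pair1' meas[OF that]] by fastforce
      then show "(\<integral>\<^sup>+\<theta>. s (cdf (K \<omega>)) (Y \<omega>) \<theta> \<partial>?H) = s (cdf (K \<omega>)) (Y \<omega>) \<theta>"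
        using \<theta>D by (intro nn_integral_return) (auto simp: space_restrict_space)
    qed
    ultimately have "(\<integral>\<^sup>+\<omega>. s (cdf (G \<omega>)) (Y \<omega>) \<theta> \<partial>M) \<le> (\<integral>\<^sup>+\<omega>. s (cdf (P \<omega>)) (Y \<omega>) \<theta> \<partial>M)"
      using P G by simp
    from AE[OF G \<theta>D \<theta>(2) this]
    show "AE \<omega> in M. (measure (P \<omega>) {z<..} > c \<longrightarrow> measure (G \<omega>) {z..} \<ge> c) \<and>
        (measure (G \<omega>) {z<..} > c \<longrightarrow> measure (P \<omega>) {z..} \<ge> c)" .
  qed
  have single_H: "kernel_AE_eq M P G"
    if H: "sigma_finite_borel_on D H" and supp: "W \<subseteq> measure_support H"
      and fin: "expected_rule M Y (S H) P < \<infinity>"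
      and G_min: "is_arg_min (expected_rule M Y (S H)) (lattice_kernel M \<A>) G" for H G
  proof -
    let ?Q = "\<lambda>\<theta>. (\<integral>\<^sup>+\<omega>. s (cdf (G \<omega>)) (Y \<omega>) \<theta> \<partial>M) \<le> (\<integral>\<^sup>+\<omega>. s (cdf (P \<omega>)) (Y \<omega>) \<theta> \<partial>M)"
    have G: "lattice_kernel M \<A> G"
      using G_min by (simp add: is_arg_min_def)
    have ge: "expected_rule M Y (S H) G \<le> expected_rule M Y (S H) P"
      using G_min P by (auto simp: is_arg_min_def not_less)
    \<comment> \<open>Finiteness of the expected score at \<open>P\<close> carries the comparison of
      the totals over to almost every parameter.\<close>
    have Q: "AE \<theta> in H. ?Q \<theta>"
      using H le[OF G] fin ge unfolding expected_rule_def S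
      by (intro expected_mixture_AE meas' P G) (auto simp: sigma_finite_borel_on_def space[OF H])
    show ?thesis
    proof (rule kernel_AE_eqI[where D = "f ` {\<theta> \<in> D. ?Q \<theta>}"])
      show "P \<in> M \<rightarrow>\<^sub>M prob_algebra borel" "G \<in> M \<rightarrow>\<^sub>M prob_algebra borel"
        using P G kernel by auto
      show "\<exists>x \<in> f ` {\<theta> \<in> D. ?Q \<theta>}. x \<in> {a<..<b} \<times> {p<..<q}"
        if ord: "a < b" "0 \<le> p" "p < q" "q \<le> 1" for a b p q :: real
      proof -
        from box[OF ord] obtain x where x: "x \<in> W" "f x \<in> {a<..<b} \<times> {p<..<q}"
          by (rule bexE)
        \<comment> \<open>By continuity of \<open>f\<close> the preimage of the box is an open
          neighbourhood of a support point, so it contains a parameter satisfying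
          \<open>?Q\<close>.\<close>
        have V: "open (f -` ({a<..<b} \<times> {p<..<q}))" "x \<in> f -` ({a<..<b} \<times> {p<..<q})"
          using x(2) by (auto intro!: open_vimage open_Times f)
        obtain \<theta> where "\<theta> \<in> f -` ({a<..<b} \<times> {p<..<q}) \<inter> space H" "?Q \<theta>"
          using AE_meets_open[OF Q subsetD[OF supp x(1)] V] by (rule bexE)
        then have "f \<theta> \<in> {a<..<b} \<times> {p<..<q}" "\<theta> \<in> space H" "?Q \<theta>"
          by simp_all
        then show ?thesis
          unfolding space[OF H] by (intro bexI[of _ "f \<theta>"] imageI CollectI conjI)
      qed
      fix z c assume "(z, c) \<in> f ` {\<theta> \<in> D. ?Q \<theta>}"
      then obtain \<theta> where "\<theta> \<in> D" "f \<theta> = (z, c)" "?Q \<theta>" by auto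
      then show "AE \<omega> in M. (measure (P \<omega>) {z<..} > c \<longrightarrow> measure (G \<omega>) {z..} \<ge> c) \<and>
          (measure (G \<omega>) {z<..} > c \<longrightarrow> measure (P \<omega>) {z..} \<ge> c)"
        by (rule AE[OF G])
    qed
  qed
  show "unique_minimizer M \<A> Y D W S P"
    unfolding unique_minimizer_def using all_H single_H by blast
qed

end

section \<open>Joint measurability of the elementary scores\<close>

lemma threshold_score_measurable:
  assumes G: "G \<in> M \<rightarrow>\<^sub>M prob_algebra borel" and [measurable]: "Y \<in> borel_measurable M"
  shows "(\<lambda>(\<omega>, z, \<eta>). ennreal (score_E \<eta> (cdf (G \<omega>) z) (of_bool (Y \<omega> \<le> z))))
    \<in> borel_measurable (M \<Otimes>\<^sub>M restrict_space borel UNIV)"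
proof -
  have [measurable]: "(\<lambda>w. cdf (G (fst w)) (fst (snd w))) \<in> borel_measurable (M \<Otimes>\<^sub>M (borel \<Otimes>\<^sub>M (borel :: real measure)))"
    using measurable_compose[OF _ kernel_cdf_measurable[OF G],
      of "\<lambda>w. (fst w, fst (snd w))" "M \<Otimes>\<^sub>M (borel \<Otimes>\<^sub>M (borel :: real measure))"]
    by simp
  have "(\<lambda>(\<omega>, z, \<eta>). ennreal (score_E \<eta> (cdf (G \<omega>) z) (of_bool (Y \<omega> \<le> z))))
    \<in> borel_measurable (M \<Otimes>\<^sub>M (borel \<Otimes>\<^sub>M borel))"
    unfolding score_E_def case_prod_beta by measurable
  then show ?thesis by (simp add: borel_prod)
qed

text \<open>The superlevel sets of the quantile, jointly in \<omega> and the level, are described by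
  \<open>less_quantile_iff\<close>, which applies because the levels are restricted to
  (0,1).\<close>

lemma quantile_score_measurable:
  assumes G [measurable]: "G \<in> M \<rightarrow>\<^sub>M prob_algebra borel" and [measurable]: "Y \<in> borel_measurable M"
  shows "(\<lambda>(\<omega>, \<alpha>, \<eta>). ennreal (score_Q \<alpha> \<eta> (quantile (cdf (G \<omega>)) \<alpha>) (Y \<omega>)))
    \<in> borel_measurable (M \<Otimes>\<^sub>M restrict_space borel ({0<..<1} \<times> UNIV))"
proof -
  let ?N = "M \<Otimes>\<^sub>M restrict_space (borel :: (real \<times> real) measure) ({0<..<1} \<times> UNIV)"
  have "(\<lambda>x. x) \<in> restrict_space (borel :: (real \<times> real) measure) ({0<..<1} \<times> UNIV) \<rightarrow>\<^sub>M borel \<Otimes>\<^sub>M borel"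
    unfolding borel_prod by (rule measurable_restrict_space1) simp
  then have [measurable]: "snd \<in> ?N \<rightarrow>\<^sub>M borel \<Otimes>\<^sub>M borel"
    by (rule measurable_compose[OF measurable_snd])
  have [measurable]: "(\<lambda>w. quantile (cdf (G (fst w))) (fst (snd w))) \<in> borel_measurable ?N"
    unfolding borel_measurable_iff_greater
  proof
    fix x
    have "x < quantile (cdf (G (fst w))) (fst (snd w)) \<longleftrightarrow> measure (G (fst w)) {..x} < fst (snd w)"
      if "w \<in> space ?N" for w
    proof -
      have w: "fst w \<in> space M" "0 < fst (snd w)" "fst (snd w) < 1"
        using that by (auto simp: space_pair_measure space_restrict_space)
      from real_distribution.less_quantile_iff[OF kernel_real_distribution[OF G w(1)] w(2,3)]
      show ?thesis by (simp add: cdf_def2)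
    qed
    then have "{w \<in> space ?N. x < quantile (cdf (G (fst w))) (fst (snd w))} =
        {w \<in> space ?N. measure (G (fst w)) {..x} < fst (snd w)}"
      by blast
    also have "\<dots> \<in> sets ?N" by measurable
    finally show "{w \<in> space ?N. x < quantile (cdf (G (fst w))) (fst (snd w))} \<in> sets ?N" .
  qed
  show ?thesis
    unfolding score_Q_def case_prod_beta by measurable
qed

section \<open>Mixtures over thresholds and over quantile levels, and scores of a single
  functional\<close>

theorem theorem4p2:
  fixes M :: "'a measure" and \<A> :: "'a set set"
    and Y :: "'a \<Rightarrow> real" and P :: "'a \<Rightarrow> real measure"
  assumes "prob_space M"
    and "Y \<in> borel_measurable M"
    and "sigma_lattice M \<A>"
    and "is_ICL M \<A> Y P"
  shows
    "((\<forall>H. sigma_finite_borel_on UNIV H \<longrightarrow>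
          is_arg_min (expected_rule M Y (threshold_rule H)) (lattice_kernel M \<A>) P) \<and>
      unique_minimizer M \<A> Y UNIV (UNIV \<times> {0<..<1}) threshold_rule P \<and>
      (\<forall>z H. sigma_finite_borel_on UNIV H \<longrightarrow>
          is_arg_min (\<lambda>X. \<integral>\<^sup>+\<omega>. mean_score H (X \<omega>) (of_bool (Y \<omega> > z)) \<partial>M)
            (lattice_measurable M \<A>) (\<lambda>\<omega>. measure (P \<omega>) {z<..}))) \<and>
     ((\<forall>\<alpha> \<in> {0<..<1}.
          absolutely_continuous lborel
            (distr M borel (\<lambda>\<omega>. (quantile (cdf (P \<omega>)) \<alpha>, Y \<omega>))) \<or>
          (let T = measure_support (distr M borel (\<lambda>\<omega>. quantile (cdf (P \<omega>)) \<alpha>))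
           in countable T \<and> \<not> (\<exists>x. x islimpt T))) \<longrightarrow>
      (\<forall>H. sigma_finite_borel_on ({0<..<1} \<times> UNIV) H \<longrightarrow>
          is_arg_min (expected_rule M Y (quantile_rule H)) (lattice_kernel M \<A>) P) \<and>
      unique_minimizer M \<A> Y ({0<..<1} \<times> UNIV) ({0<..<1} \<times> UNIV) quantile_rule P \<and>
      (\<forall>\<alpha> \<in> {0<..<1}. \<forall>H. sigma_finite_borel_on UNIV H \<longrightarrow>
          is_arg_min (\<lambda>X. \<integral>\<^sup>+\<omega>. quantile_score \<alpha> H (X \<omega>) (Y \<omega>) \<partial>M)
            (lattice_measurable M \<A>) (\<lambda>\<omega>. quantile (cdf (P \<omega>)) \<alpha>)))"
proof -
  interpret prob_space M by fact
  note Y [measurable] = assms(2) and \<A> = assms(3) and icl = assms(4)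
  have \<A>': "\<A> \<subseteq> sets M" using \<A> by (simp add: sigma_lattice_def)
  have P: "lattice_kernel M \<A> P"
    and cp: "\<And>y. is_cond_prob M \<A> {\<omega> \<in> space M. Y \<omega> > y} (\<lambda>\<omega>. measure (P \<omega>) {y<..})"
    using icl by (auto simp: is_ICL_def lattice_kernel_def is_cond_prob_def is_cond_exp_def)
  have kernel: "G \<in> M \<rightarrow>\<^sub>M prob_algebra borel" if "lattice_kernel M \<A> G" for G
    using that by (simp add: lattice_kernel_def)
  have sets_H: "sets H = sets borel" and sigma_finite_H: "sigma_finite_measure H"
    if "sigma_finite_borel_on UNIV H" for H :: "real measure"
    using that by (simp_all add: sigma_finite_borel_on_def)

  let ?sE = "\<lambda>F y (z, \<eta>). ennreal (score_E \<eta> (F z) (of_bool (y \<le> z)))"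
  \<comment> \<open>The maps send a mixing parameter to the point and tail level that it tests:
    level \<eta> for the cdf at \<open>z\<close> is level \<open>1 - \<eta>\<close> for the mass
    above \<open>z\<close>, and comparing the \<alpha>-quantile with \<eta> tests the mass above
    \<eta> at level \<open>1 - \<alpha>\<close>.\<close>
  have swap: "continuous_on UNIV (\<lambda>(x :: real, y :: real). (x, 1 - y))"
    "continuous_on UNIV (\<lambda>(x :: real, y :: real). (y, 1 - x))"
    unfolding case_prod_beta by (intro continuous_intros)+
  have cover: "UNIV \<times> {0<..<1} \<subseteq> (\<lambda>(z :: real, \<eta> :: real). (z, 1 - \<eta>)) ` (UNIV \<times> {0<..<1})"
    "UNIV \<times> {0<..<1} \<subseteq> (\<lambda>(\<alpha> :: real, \<eta> :: real). (\<eta>, 1 - \<alpha>)) ` ({0<..<1} \<times> UNIV)"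
  proof -
    have "\<exists>x \<in> UNIV \<times> {0<..<1}. (z, c) = (\<lambda>(z :: real, \<eta> :: real). (z, 1 - \<eta>)) x"
      "\<exists>x \<in> {0<..<1} \<times> UNIV. (z, c) = (\<lambda>(\<alpha> :: real, \<eta> :: real). (\<eta>, 1 - \<alpha>)) x"
      if "0 < c" "c < 1" for z c
      using that by (auto intro!: bexI[of _ "1 - c"])
    then show "UNIV \<times> {0<..<1} \<subseteq> (\<lambda>(z :: real, \<eta> :: real). (z, 1 - \<eta>)) ` (UNIV \<times> {0<..<1})"
      "UNIV \<times> {0<..<1} \<subseteq> (\<lambda>(\<alpha> :: real, \<eta> :: real). (\<eta>, 1 - \<alpha>)) ` ({0<..<1} \<times> UNIV)"
      by (auto simp: image_iff)
  qed
  have threshold_rule: "threshold_rule H F y = (\<integral>\<^sup>+\<theta>. ?sE F y \<theta> \<partial>H)" for H F y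
    by (simp add: threshold_rule_def)
  have threshold_meas: "(\<lambda>(\<omega>, \<theta>). ?sE (cdf (G \<omega>)) (Y \<omega>) \<theta>)
      \<in> borel_measurable (M \<Otimes>\<^sub>M restrict_space borel UNIV)" if "lattice_kernel M \<A> G" for G
    using threshold_score_measurable[OF kernel[OF that] Y] by simp
  have threshold_le: "(\<integral>\<^sup>+\<omega>. ?sE (cdf (P \<omega>)) (Y \<omega>) \<theta> \<partial>M) \<le> (\<integral>\<^sup>+\<omega>. ?sE (cdf (G \<omega>)) (Y \<omega>) \<theta> \<partial>M)"
    if "lattice_kernel M \<A> G" for G \<theta>
    using threshold_score_le[OF Y icl \<A>' that] by (cases \<theta>) simp
  have threshold_AE: "AE \<omega> in M. (measure (P \<omega>) {z<..} > c \<longrightarrow> measure (G \<omega>) {z..} \<ge> c) \<and>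
        (measure (G \<omega>) {z<..} > c \<longrightarrow> measure (P \<omega>) {z..} \<ge> c)"
    if "lattice_kernel M \<A> G" "(\<lambda>(z, \<eta>). (z, 1 - \<eta>)) \<theta> = (z, c)"
      "(\<integral>\<^sup>+\<omega>. ?sE (cdf (G \<omega>)) (Y \<omega>) \<theta> \<partial>M) \<le> (\<integral>\<^sup>+\<omega>. ?sE (cdf (P \<omega>)) (Y \<omega>) \<theta> \<partial>M)" for G \<theta> z c
  proof -
    have \<theta>: "\<theta> = (z, 1 - c)" using that(2) by (cases \<theta>) auto
    show ?thesis
      using threshold_score_AE[OF Y icl \<A>' that(1), of "1 - c" z] that(3) by (simp add: \<theta>)
  qed
  note threshold = mixture_rule_optimal[where s = ?sE and S = threshold_rule and D = UNIV,
      OF P threshold_rule threshold_meas threshold_le threshold_AE subset_UNIV swap(1) cover(1)]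

  let ?sQ = "\<lambda>F y (\<alpha>, \<eta>). ennreal (score_Q \<alpha> \<eta> (quantile F \<alpha>) y)"
  let ?D = "{0<..<1} \<times> UNIV :: (real \<times> real) set"
  have quantile_rule: "quantile_rule H F y = (\<integral>\<^sup>+\<theta>. ?sQ F y \<theta> \<partial>H)" for H F y
    by (simp add: quantile_rule_def)
  have quantile_meas: "(\<lambda>(\<omega>, \<theta>). ?sQ (cdf (G \<omega>)) (Y \<omega>) \<theta>)
      \<in> borel_measurable (M \<Otimes>\<^sub>M restrict_space borel ?D)" if "lattice_kernel M \<A> G" for G
    using quantile_score_measurable[OF kernel[OF that] Y] by simp
  have quantile_le: "(\<integral>\<^sup>+\<omega>. ?sQ (cdf (P \<omega>)) (Y \<omega>) \<theta> \<partial>M) \<le> (\<integral>\<^sup>+\<omega>. ?sQ (cdf (G \<omega>)) (Y \<omega>) \<theta> \<partial>M)"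
    if G: "lattice_kernel M \<A> G" and "\<theta> \<in> ?D" for G \<theta>
  proof -
    obtain \<alpha> \<eta> where \<theta>: "\<theta> = (\<alpha>, \<eta>)" "0 < \<alpha>" "\<alpha> < 1" using \<open>\<theta> \<in> ?D\<close> by (cases \<theta>) auto
    show ?thesis
      using quantile_score_le[OF Y icl \<A> \<theta>(2,3) lattice_measurable_quantile[OF G \<theta>(2,3)]]
      by (simp add: \<theta>(1))
  qed
  have quantile_AE: "AE \<omega> in M. (measure (P \<omega>) {z<..} > c \<longrightarrow> measure (G \<omega>) {z..} \<ge> c) \<and>
        (measure (G \<omega>) {z<..} > c \<longrightarrow> measure (P \<omega>) {z..} \<ge> c)"
    if G: "lattice_kernel M \<A> G" and D: "\<theta> \<in> ?D" and f: "(\<lambda>(\<alpha>, \<eta>). (\<eta>, 1 - \<alpha>)) \<theta> = (z, c)"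
      and le: "(\<integral>\<^sup>+\<omega>. ?sQ (cdf (G \<omega>)) (Y \<omega>) \<theta> \<partial>M) \<le> (\<integral>\<^sup>+\<omega>. ?sQ (cdf (P \<omega>)) (Y \<omega>) \<theta> \<partial>M)"
    for G \<theta> z c
  proof -
    obtain \<alpha> where \<theta>: "\<theta> = (\<alpha>, z)" and \<alpha>: "0 < \<alpha>" "\<alpha> < 1" and c: "c = 1 - \<alpha>"
      using D f by (cases \<theta>) auto
    have "AE \<omega> in M. (measure (P \<omega>) {z..} > c \<longrightarrow> z \<le> quantile (cdf (G \<omega>)) \<alpha>) \<and>
        (z \<le> quantile (cdf (G \<omega>)) \<alpha> \<longrightarrow> measure (P \<omega>) {z..} \<ge> c)"
      using quantile_score_AE[OF Y icl \<A> \<alpha> lattice_measurable_quantile[OF G \<alpha>], of z] le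
      by (simp add: \<theta> c)
    then show ?thesis
    proof (rule AE_mp, intro AE_I2 impI)
      fix \<omega> assume \<omega>: "\<omega> \<in> space M"
        and ae: "(measure (P \<omega>) {z..} > c \<longrightarrow> z \<le> quantile (cdf (G \<omega>)) \<alpha>) \<and>
        (z \<le> quantile (cdf (G \<omega>)) \<alpha> \<longrightarrow> measure (P \<omega>) {z..} \<ge> c)"
      interpret P\<omega>: real_distribution "P \<omega>"
        by (rule kernel_real_distribution[OF kernel[OF P] \<omega>])
      interpret G\<omega>: real_distribution "G \<omega>"
        by (rule kernel_real_distribution[OF kernel[OF G] \<omega>])
      have "measure (P \<omega>) {z<..} \<le> measure (P \<omega>) {z..}"
        by (intro P\<omega>.finite_measure_mono) auto
      \<comment> \<open>Quantiles of \<open>G\<close> are translated into masses: a quantile at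
        least \<open>z\<close> bounds the mass of \<open>{z..}\<close> from below, and a mass of
        \<open>{z<..}\<close> beyond \<open>c\<close> puts the quantile beyond
        \<open>z\<close>.\<close>
      moreover have "c \<le> measure (G \<omega>) {z..}" if "z \<le> quantile (cdf (G \<omega>)) \<alpha>"
        using G\<omega>.upper_measure_ge[OF \<alpha> that] c by simp
      moreover have "z < quantile (cdf (G \<omega>)) \<alpha>" if "c < measure (G \<omega>) {z<..}"
        using that G\<omega>.cdf_eq_upper[of z] c by (simp add: G\<omega>.less_quantile_iff[OF \<alpha>])
      ultimately show "(measure (P \<omega>) {z<..} > c \<longrightarrow> measure (G \<omega>) {z..} \<ge> c) \<and>
          (measure (G \<omega>) {z<..} > c \<longrightarrow> measure (P \<omega>) {z..} \<ge> c)"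
        using ae by fastforce
    qed
  qed
  note quantile = mixture_rule_optimal[where s = ?sQ and S = quantile_rule and D = ?D,
      OF P quantile_rule quantile_meas quantile_le quantile_AE subset_refl swap(2) cover(2)]

  \<comment> \<open>For a single threshold or level the same integration over \<eta> applies, with
    arbitrary lattice-measurable reports as competitors.\<close>
  have mean: "is_arg_min (\<lambda>X. \<integral>\<^sup>+\<omega>. mean_score H (X \<omega>) (of_bool (Y \<omega> > z)) \<partial>M)
      (lattice_measurable M \<A>) (\<lambda>\<omega>. measure (P \<omega>) {z<..})" if H: "sigma_finite_borel_on UNIV H" for z H
  proof -
    have X: "lattice_measurable M \<A> (\<lambda>\<omega>. measure (P \<omega>) {z<..})"
      using P by (simp add: lattice_kernel_def)
    have meas: "(\<lambda>(\<omega>, \<eta>). ennreal (score_E \<eta> (V \<omega>) (of_bool (Y \<omega> > z)))) \<in> borel_measurable (M \<Otimes>\<^sub>M H)"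
      if "lattice_measurable M \<A> V" for V
    proof -
      have [measurable]: "V \<in> borel_measurable M" using that by (simp add: lattice_measurable_def)
      note [measurable_cong] = sets_H[OF H]
      show ?thesis unfolding score_E_def case_prod_beta by measurable
    qed
    have "(\<integral>\<^sup>+\<omega>. mean_score H (measure (P \<omega>) {z<..}) (of_bool (Y \<omega> > z)) \<partial>M)
        \<le> (\<integral>\<^sup>+\<omega>. mean_score H (V \<omega>) (of_bool (Y \<omega> > z)) \<partial>M)" if V: "lattice_measurable M \<A> V" for V
      unfolding mean_score_def
      using sigma_finite_H[OF H] meas[OF X] meas[OF V] mean_score_elementary_le[OF cp _ \<A> V]
      by (intro expected_mixture_le) auto
    with X show ?thesis by (auto simp: is_arg_min_def not_less)
  qed
  have quantile_single: "is_arg_min (\<lambda>X. \<integral>\<^sup>+\<omega>. quantile_score \<alpha> H (X \<omega>) (Y \<omega>) \<partial>M)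
      (lattice_measurable M \<A>) (\<lambda>\<omega>. quantile (cdf (P \<omega>)) \<alpha>)"
    if \<alpha>: "0 < \<alpha>" "\<alpha> < 1" and H: "sigma_finite_borel_on UNIV H" for \<alpha> H
  proof -
    have X: "lattice_measurable M \<A> (\<lambda>\<omega>. quantile (cdf (P \<omega>)) \<alpha>)"
      by (rule lattice_measurable_quantile[OF P \<alpha>])
    have meas: "(\<lambda>(\<omega>, \<eta>). ennreal (score_Q \<alpha> \<eta> (V \<omega>) (Y \<omega>))) \<in> borel_measurable (M \<Otimes>\<^sub>M H)"
      if "lattice_measurable M \<A> V" for V
    proof -
      have [measurable]: "V \<in> borel_measurable M" using that by (simp add: lattice_measurable_def)
      note [measurable_cong] = sets_H[OF H]
      show ?thesis unfolding score_Q_def case_prod_beta by measurable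
    qed
    have "(\<integral>\<^sup>+\<omega>. quantile_score \<alpha> H (quantile (cdf (P \<omega>)) \<alpha>) (Y \<omega>) \<partial>M)
        \<le> (\<integral>\<^sup>+\<omega>. quantile_score \<alpha> H (V \<omega>) (Y \<omega>) \<partial>M)" if V: "lattice_measurable M \<A> V" for V
      unfolding quantile_score_def
      using sigma_finite_H[OF H] meas[OF X] meas[OF V] quantile_score_le[OF Y icl \<A> \<alpha> V]
      by (intro expected_mixture_le) auto
    with X show ?thesis by (auto simp: is_arg_min_def not_less)
  qed
  show ?thesis
    by (intro conjI impI allI ballI) (rule threshold quantile mean quantile_single; simp)+
qed

end
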